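(* For every $n \in \omega$, the $n$-uniform degrees $\mathcal{M}_n$, with the ordering induced by $\leq_n$, form a Brouwer algebra.
   Context: A mass problem is a subset of $\omega^\omega$. $\Phi_e$ is the Turing functional with index $e$; writing $\Phi_e(f)\in\mathcal{A}$ means in particular that $\Phi_e(f)$ is total. $\Pi^0_n$-classes are the effective (lightface) $\Pi^0_n$ subsets of $\omega^\omega$, with a fixed effective listing $\{\mathcal{P}^n_e\}_{e\in\omega}$; a sequence $\mathcal{V}_0,\mathcal{V}_1,\dots$ is uniformly $\Pi^0_n$ if there is a computable sequence $u_0,u_1,\dots$ with $\mathcal{V}_i=\mathcal{P}^n_{u_i}$ for all $i$. For $n=0$, $\Pi^0_0$-classes are finite Boolean combinations of cylinders $\{f \mid \sigma\subset f\}$, $\sigma\in\omega^{<\omega}$. For $n\in\omega$ and $\mathcal{A},\mathcal{B}\subseteq\omega^\omega$, $\mathcal{A}\leq_n\mathcal{B}$ ($\mathcal{A}$ $n$-uniformly reduces to $\mathcal{B}$) means: there are a uniformly $\Pi^0_n$ sequence $\mathcal{V}_0,\mathcal{V}_1,\dots$ with $\mathcal{B}\subseteq\bigcup_i\mathcal{V}_i$ and a computable sequence $e_0,e_1,\dots$ such that for every $i$ and every $f\in\mathcal{B}\cap\mathcal{V}_i$ we have $\Phi_{e_i}(f)\in\mathcal{A}$. $\mathcal{A}\equiv_n\mathcal{B}$ means $\mathcal{A}\leq_n\mathcal{B}$ and $\mathcal{B}\leq_n\mathcal{A}$. $\mathcal{M}_n=\mathcal{P}(\omega^\omega)/{\equiv_n}$,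 ordered by $\leq_n$; its elements are the $n$-uniform degrees. A Brouwer algebra is a bounded distributive lattice, with join $\oplus$ and meet $\otimes$, with a binary operation $\to$ such that for all $a,b,c$: $a\oplus c\geq b$ if and only if $c\geq a\to b$ (that is, $a \to b$ is the least $c$ with $a \oplus c \geq b$). *)

theory Defs
  imports "HOL-Library.Nat_Bijection" "HOL-Algebra.Lattice"
begin

section \<open>Turing functionals\<close>

text \<open>
  Programs for partial functions on the natural numbers that are recursive relative to an oracle.
  Programs are unary; several arguments are passed as one number by means of the Cantor pairing
  \<^const>\<open>prod_encode\<close>.
\<close>

datatype prog =
    Zero
  | Succ
  | Fst
  | Snd
  | Oracle
  | Tup prog prog
  | Comp prog prog
  | Prec prog prog
  | Mu prog

text \<open>
  \<open>run f p x\<close> is the result of \<open>p\<close> on input \<open>x\<close> with oracle \<open>f\<close>, and \<^const>\<open>None\<close> if the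
  computation diverges. In particular, the search for the least zero \<open>m\<close> requires the
  searched function to be defined and nonzero at all arguments below \<open>m\<close>.
\<close>

primrec run :: "(nat \<Rightarrow> nat) \<Rightarrow> prog \<Rightarrow> nat \<Rightarrow> nat option" where
  "run f Zero x = Some 0"
| "run f Succ x = Some (Suc x)"
| "run f Fst x = Some (fst (prod_decode x))"
| "run f Snd x = Some (snd (prod_decode x))"
| "run f Oracle x = Some (f x)"
| "run f (Tup p q) x =
     Option.bind (run f p x) (\<lambda>a. Option.bind (run f q x) (\<lambda>b. Some (prod_encode (a, b))))"
| "run f (Comp p q) x = Option.bind (run f q x) (run f p)"
| "run f (Prec p q) x =
     (let (a, k) = prod_decode x in
      rec_nat (run f p a)
        (\<lambda>j r. Option.bind r (\<lambda>y. run f q (prod_encode (a, prod_encode (j, y))))) k)"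
| "run f (Mu p) x =
     (let zero_at = (\<lambda>m. run f p (prod_encode (x, m)) = Some 0 \<and>
                         (\<forall>j<m. \<exists>y>0. run f p (prod_encode (x, j)) = Some y))
      in if \<exists>m. zero_at m then Some (LEAST m. zero_at m) else None)"

text \<open>
  The numbering of programs: the residue modulo 9 selects the constructor, the quotient codes the
  arguments. It is onto (see below) but not injective, so every functional has infinitely many
  indices.
\<close>

lemma prod_decode_bounds:
  "fst (prod_decode k) \<le> k" "snd (prod_decode k) \<le> k"
  using le_prod_encode_1[of "fst (prod_decode k)" "snd (prod_decode k)"]
    le_prod_encode_2[of "snd (prod_decode k)" "fst (prod_decode k)"]
  by simp_all

lemma prod_decode_div_less:
  assumes "0 < e" "1 < c"
  shows "fst (prod_decode (e div c)) < e" "snd (prod_decode (e div c)) < e"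
  using prod_decode_bounds[of "e div c"] assms div_less_dividend[of c e]
  by linarith+

function prog_of :: "nat \<Rightarrow> prog" where
  "prog_of e =
    (let k = e div 9; i = fst (prod_decode k); j = snd (prod_decode k) in
     if e mod 9 = 0 then Zero
     else if e mod 9 = 1 then Succ
     else if e mod 9 = 2 then Fst
     else if e mod 9 = 3 then Snd
     else if e mod 9 = 4 then Oracle
     else if e mod 9 = 5 then Tup (prog_of i) (prog_of j)
     else if e mod 9 = 6 then Comp (prog_of i) (prog_of j)
     else if e mod 9 = 7 then Prec (prog_of i) (prog_of j)
     else Mu (prog_of k))"
  by pat_completeness auto
termination
proof (relation "measure (\<lambda>e. e)", goal_cases)
  case 1
  then show ?case by simp
qed (auto intro!: prod_decode_div_less div_less_dividend Nat.gr0I)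

declare prog_of.simps [simp del]

lemma surj_prog_of: "surj prog_of"
proof -
  have mod9: "(9 * k + r) mod 9 = r" "(9 * k + r) div 9 = k" if "r < 9" for k r :: nat
    using that by simp_all
  have "\<exists>e. prog_of e = p" for p
  proof (induction p)
    case Zero
    show ?case by (rule exI[of _ 0]) (simp add: prog_of.simps)
  next
    case Succ
    show ?case by (rule exI[of _ 1]) (simp add: prog_of.simps)
  next
    case Fst
    show ?case by (rule exI[of _ 2]) (simp add: prog_of.simps)
  next
    case Snd
    show ?case by (rule exI[of _ 3]) (simp add: prog_of.simps)
  next
    case Oracle
    show ?case by (rule exI[of _ 4]) (simp add: prog_of.simps)
  next
    case (Tup p q)
    then obtain a b where "prog_of a = p" "prog_of b = q" by blast
    then show ?case
      by (intro exI[of _ "9 * prod_encode (a, b) + 5"], subst prog_of.simps)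
        (simp add: mod9)
  next
    case (Comp p q)
    then obtain a b where "prog_of a = p" "prog_of b = q" by blast
    then show ?case
      by (intro exI[of _ "9 * prod_encode (a, b) + 6"], subst prog_of.simps)
        (simp add: mod9)
  next
    case (Prec p q)
    then obtain a b where "prog_of a = p" "prog_of b = q" by blast
    then show ?case
      by (intro exI[of _ "9 * prod_encode (a, b) + 7"], subst prog_of.simps)
        (simp add: mod9)
  next
    case (Mu p)
    then obtain a where "prog_of a = p" by blast
    then show ?case
      by (intro exI[of _ "9 * a + 8"], subst prog_of.simps)
        (simp add: mod9)
  qed
  then show ?thesis by (metis surj_def)
qed

definition Phi :: "nat \<Rightarrow> (nat \<Rightarrow> nat) \<Rightarrow> nat \<Rightarrow> nat option" where
  "Phi e f = run f (prog_of e)"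

definition Phi_in :: "nat \<Rightarrow> (nat \<Rightarrow> nat) \<Rightarrow> (nat \<Rightarrow> nat) set \<Rightarrow> bool" where
  "Phi_in e f A \<longleftrightarrow> (\<exists>g\<in>A. \<forall>x. Phi e f x = Some (g x))"

text \<open>Computability without an oracle is computability relative to the constant zero function.\<close>

definition computable :: "(nat \<Rightarrow> nat) \<Rightarrow> bool" where
  "computable u \<longleftrightarrow> (\<exists>e. \<forall>x. Phi e (\<lambda>_. 0) x = Some (u x))"

definition W :: "nat \<Rightarrow> nat set" where
  "W e = {x. Phi e (\<lambda>_. 0) x \<noteq> None}"


section \<open>\<open>\<Pi>\<^sup>0\<^sub>n\<close>-classes\<close>

definition cylinder :: "nat list \<Rightarrow> (nat \<Rightarrow> nat) set" where
  "cylinder \<sigma> = {f. \<forall>i<length \<sigma>. f i = \<sigma> ! i}"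

datatype bcomb = Cyl "nat list" | Neg bcomb | Conj bcomb bcomb

primrec bclass :: "bcomb \<Rightarrow> (nat \<Rightarrow> nat) set" where
  "bclass (Cyl \<sigma>) = cylinder \<sigma>"
| "bclass (Neg b) = - bclass b"
| "bclass (Conj b c) = bclass b \<inter> bclass c"

function bcomb_of :: "nat \<Rightarrow> bcomb" where
  "bcomb_of e =
    (let k = e div 3 in
     if e mod 3 = 0 then Cyl (list_decode k)
     else if e mod 3 = 1 then Neg (bcomb_of k)
     else Conj (bcomb_of (fst (prod_decode k))) (bcomb_of (snd (prod_decode k))))"
  by pat_completeness auto
termination
proof (relation "measure (\<lambda>e. e)", goal_cases)
  case 1
  then show ?case by simp
qed (auto intro!: prod_decode_div_less div_less_dividend Nat.gr0I)

declare bcomb_of.simps [simp del]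

lemma surj_bcomb_of: "surj bcomb_of"
proof -
  have Suc3: "Suc (3 * k) div 3 = k" "Suc (3 * k) mod 3 = 1"
    "Suc (Suc (3 * k)) div 3 = k" "Suc (Suc (3 * k)) mod 3 = 2" for k :: nat
    by presburger+
  have "\<exists>e. bcomb_of e = b" for b
  proof (induction b)
    case (Cyl \<sigma>)
    show ?case
      by (rule exI[of _ "3 * list_encode \<sigma>"], subst bcomb_of.simps) simp
  next
    case (Neg b)
    then obtain a where "bcomb_of a = b" by blast
    then show ?case
      by (intro exI[of _ "3 * a + 1"], subst bcomb_of.simps) (simp add: Suc3)
  next
    case (Conj b c)
    then obtain i j where "bcomb_of i = b" "bcomb_of j = c" by blast
    then show ?case
      by (intro exI[of _ "3 * prod_encode (i, j) + 2"], subst bcomb_of.simps)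
        (simp add: Suc3)
  qed
  then show ?thesis by (metis surj_def)
qed

text \<open>
  \<open>Pi_class n e\<close> is the \<open>e\<close>-th \<open>\<Pi>\<^sup>0\<^sub>n\<close>-class \<open>\<P>\<^sup>n\<^sub>e\<close>. The listing follows the effective Borel
  hierarchy: a \<open>\<Sigma>\<^sup>0\<^sub>n\<^sub>+\<^sub>1\<close>-class is the union of a computably enumerable family of
  \<open>\<Pi>\<^sup>0\<^sub>n\<close>-classes (given by indices), and a \<open>\<Pi>\<^sup>0\<^sub>n\<^sub>+\<^sub>1\<close>-class is the complement of a
  \<open>\<Sigma>\<^sup>0\<^sub>n\<^sub>+\<^sub>1\<close>-class.
\<close>

primrec Pi_class :: "nat \<Rightarrow> nat \<Rightarrow> (nat \<Rightarrow> nat) set" where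
  "Pi_class 0 e = bclass (bcomb_of e)"
| "Pi_class (Suc n) e = - (\<Union>x\<in>W e. Pi_class n x)"

definition uniformly_Pi :: "nat \<Rightarrow> (nat \<Rightarrow> (nat \<Rightarrow> nat) set) \<Rightarrow> bool" where
  "uniformly_Pi n V \<longleftrightarrow> (\<exists>u. computable u \<and> (\<forall>i. V i = Pi_class n (u i)))"


section \<open>\<open>n\<close>-uniform reducibility and degrees\<close>

type_synonym mass_problem = "(nat \<Rightarrow> nat) set"

definition unif_le :: "nat \<Rightarrow> mass_problem \<Rightarrow> mass_problem \<Rightarrow> bool" where
  "unif_le n A B \<longleftrightarrow>
    (\<exists>V. uniformly_Pi n V \<and> B \<subseteq> (\<Union>i. V i) \<and>
      (\<exists>e. computable e \<and> (\<forall>i. \<forall>f \<in> B \<inter> V i. Phi_in (e i) f A)))"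

definition unif_equiv :: "nat \<Rightarrow> (mass_problem \<times> mass_problem) set" where
  "unif_equiv n = {(A, B). unif_le n A B \<and> unif_le n B A}"

definition uniform_degrees :: "nat \<Rightarrow> mass_problem set gorder" where
  "uniform_degrees n =
    \<lparr>carrier = UNIV // unif_equiv n,
     eq = (=),
     le = (\<lambda>a b. \<exists>A\<in>a. \<exists>B\<in>b. unif_le n A B)\<rparr>"


section \<open>Brouwer algebras\<close>

text \<open>
  Join and meet are the operations \<open>\<squnion>\<close> and \<open>\<sqinter>\<close> determined by the order. Note that \<open>imp a b\<close> is
  the least \<open>c\<close> whose join with \<open>a\<close> lies above \<open>b\<close>, so this is the order dual of a Heyting
  algebra.
\<close>

locale brouwer_algebra = bounded_lattice L for L (structure) +
  assumes join_meet_distrib: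
    "\<lbrakk>x \<in> carrier L; y \<in> carrier L; z \<in> carrier L\<rbrakk>
      \<Longrightarrow> x \<squnion> (y \<sqinter> z) = (x \<squnion> y) \<sqinter> (x \<squnion> z)"
    and imp_exists:
    "\<exists>imp \<in> carrier L \<rightarrow> carrier L \<rightarrow> carrier L.
       \<forall>a\<in>carrier L. \<forall>b\<in>carrier L. \<forall>c\<in>carrier L. b \<sqsubseteq> a \<squnion> c \<longleftrightarrow> imp a b \<sqsubseteq> c"

end

theory Submission
  imports Defs
begin

text \<open>
  Work with uniformly \<open>\<Sigma>\<^sup>0\<^sub>n\<^sub>+\<^sub>1\<close> rather than uniformly \<open>\<Pi>\<^sup>0\<^sub>n\<close> covers: a \<open>\<Sigma>\<^sup>0\<^sub>n\<^sub>+\<^sub>1\<close>-class is effectively a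
  union of \<open>\<Pi>\<^sup>0\<^sub>n\<close>-classes, so this does not change \<open>\<le>\<^sub>n\<close>, and a universal program makes it enough
  to use one functional with the index of the class as a parameter. The \<open>\<Sigma>\<^sup>0\<^sub>n\<^sub>+\<^sub>1\<close>-classes are closed
  under finite intersections and under preimages along functionals (on their domain), which gives
  transitivity; join and meet are those of the Medvedev lattice. Since there is a universal
  uniformly \<open>\<Sigma>\<^sup>0\<^sub>n\<^sub>+\<^sub>1\<close> sequence, reductions can be coded by numbers, and \<open>A \<rightarrow> B\<close> consists of the pairs
  of a code and a function \<open>f\<close> such that the coded reduction sends \<open>g \<oplus> f\<close> into \<open>B\<close> for all \<open>g\<close> in \<open>A\<close>.
\<close>

section \<open>Recursive functionals\<close>

text \<open>Preimages force the passage to Sigma classes. Under the total functional with constant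
  value f (f 0), the preimage of a cylinder can be the class of all f with f (f 0) = 0; this is not
  a finite Boolean combination of cylinders, only a computable union of them. Moreover a reduction
  need be total only on part of the space, so a preimage is required to be right only where the
  reduction is total. No definability is asked of mass problems: the set \<open>C\<close> in the
  implication may quantify over all of \<open>A\<close>, and only the cover belonging to a code has
  to be effective. The code is stored as the value at 0, so recognizing it is decidable; conversely
  one reduction serves a whole mass problem, so its code can be prepended as a constant.
  Computations are bounded by their inputs and not by a number of steps. Such a bound limits
  searches and the use of the oracle at once, which serves both the universal program and the
  decomposition of open classes into cylinders.\<close>

abbreviation pfst :: "nat \<Rightarrow> nat" where
  "pfst x \<equiv> fst (prod_decode x)"

abbreviation psnd :: "nat \<Rightarrow> nat" where
  "psnd x \<equiv> snd (prod_decode x)"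

abbreviation pair :: "nat \<Rightarrow> nat \<Rightarrow> nat" where
  "pair x y \<equiv> prod_encode (x, y)"

text \<open>Totality is demanded for every oracle, so the closure rules carry no domain conditions.
  Functionals that are total only on a mass problem stay programs.\<close>

definition recfun :: "((nat \<Rightarrow> nat) \<Rightarrow> nat \<Rightarrow> nat) \<Rightarrow> bool" where
  "recfun F \<longleftrightarrow> (\<exists>p. \<forall>f x. run f p x = Some (F f x))"

definition recpred :: "((nat \<Rightarrow> nat) \<Rightarrow> nat \<Rightarrow> bool) \<Rightarrow> bool" where
  "recpred P \<longleftrightarrow> recfun (\<lambda>f x. if P f x then 1 else 0)"

section \<open>Closure of total recursive functionals: arithmetic, bounded quantifiers, search,
  course-of-values recursion\<close>

named_theorems rec_intros

lemma recfun_comp: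
  assumes "recfun F" "recfun a"
  shows "recfun (\<lambda>f x. F f (a f x))"
proof -
  obtain p q where "\<forall>f x. run f p x = Some (F f x)" "\<forall>f x. run f q x = Some (a f x)"
    using assms unfolding recfun_def by blast
  then show ?thesis
    unfolding recfun_def by (intro exI[of _ "Comp p q"]) simp
qed

lemma recpred_comp:
  assumes "recpred P" "recfun a"
  shows "recpred (\<lambda>f x. P f (a f x))"
  using recfun_comp[OF assms(1)[unfolded recpred_def] assms(2)] by (simp add: recpred_def)

lemma recfun_Suc [rec_intros]: "recfun a \<Longrightarrow> recfun (\<lambda>f x. Suc (a f x))"
  by (rule recfun_comp[of "\<lambda>f x. Suc x"]) (auto simp: recfun_def intro: exI[of _ Succ])

lemma recfun_pfst [rec_intros]: "recfun a \<Longrightarrow> recfun (\<lambda>f x. pfst (a f x))"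
  by (rule recfun_comp[of "\<lambda>f x. pfst x"]) (auto simp: recfun_def intro: exI[of _ Fst])

lemma recfun_psnd [rec_intros]: "recfun a \<Longrightarrow> recfun (\<lambda>f x. psnd (a f x))"
  by (rule recfun_comp[of "\<lambda>f x. psnd x"]) (auto simp: recfun_def intro: exI[of _ Snd])

lemma recfun_oracle [rec_intros]: "recfun a \<Longrightarrow> recfun (\<lambda>f x. f (a f x))"
  by (rule recfun_comp[of "\<lambda>f x. f x"]) (auto simp: recfun_def intro: exI[of _ Oracle])

lemma recfun_pair [rec_intros]:
  assumes "recfun a" "recfun b"
  shows "recfun (\<lambda>f x. pair (a f x) (b f x))"
proof -
  obtain p q where "\<forall>f x. run f p x = Some (a f x)" "\<forall>f x. run f q x = Some (b f x)"
    using assms unfolding recfun_def by blast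
  then show ?thesis
    unfolding recfun_def by (intro exI[of _ "Tup p q"]) simp
qed

lemma recfun_id [rec_intros]: "recfun (\<lambda>f x. x)"
  unfolding recfun_def by (intro exI[of _ "Tup Fst Snd"]) simp

lemma recfun_const [rec_intros]: "recfun (\<lambda>f x. c)"
proof (induction c)
  case 0
  show ?case unfolding recfun_def by (intro exI[of _ Zero]) simp
qed (rule recfun_Suc)

text \<open>The body of a binder is a functional of the code of the tuple of all variables in scope.\<close>

lemma recfun_rec_nat [rec_intros]:
  assumes "recfun b" "recfun (\<lambda>f z. g f (pfst z) (pfst (psnd z)) (psnd (psnd z)))" "recfun k"
  shows "recfun (\<lambda>f x. rec_nat (b f x) (\<lambda>j r. g f x j r) (k f x))"
proof -
  obtain p q where p: "\<And>f x. run f p x = Some (b f x)"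
    and q: "\<And>f x. run f q x = Some (g f (pfst x) (pfst (psnd x)) (psnd (psnd x)))"
    using assms unfolding recfun_def by blast
  have "run f (Prec p q) (pair x m) = Some (rec_nat (b f x) (\<lambda>j r. g f x j r) m)" for f x m
    by (induction m) (simp_all add: p q)
  from this[of _ "pfst z" "psnd z" for z]
  have *: "run f (Prec p q) z = Some (rec_nat (b f (pfst z)) (\<lambda>j r. g f (pfst z) j r) (psnd z))"
    for f z
    by (simp only: prod.collapse prod_decode_inverse)
  then have "recfun (\<lambda>f z. rec_nat (b f (pfst z)) (\<lambda>j r. g f (pfst z) j r) (psnd z))"
    unfolding recfun_def by (intro exI[of _ "Prec p q"] allI *)
  from recfun_comp[OF this recfun_pair[OF recfun_id assms(3)]] show ?thesis by simp
qed

text \<open>A recursion of length 0 or 1 selects the branch.\<close>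

lemma recfun_if [rec_intros]:
  assumes "recpred P" "recfun a" "recfun b"
  shows "recfun (\<lambda>f x. if P f x then a f x else b f x)"
proof -
  have "recfun (\<lambda>f x. rec_nat (b f x) (\<lambda>j r. a f x) (if P f x then 1 else 0))"
    \<comment> \<open>The branch \<open>a\<close> has moved under the binder, where its argument is
      a projection of the coded tuple.\<close>
    by (intro recfun_comp[OF assms(2)] rec_intros assms assms(1)[unfolded recpred_def])
  moreover have "(\<lambda>f x. rec_nat (b f x) (\<lambda>j r. a f x) (if P f x then 1 else 0)) =
      (\<lambda>f x. if P f x then a f x else b f x)"
    by (intro ext) simp
  ultimately show ?thesis by simp
qed

lemma recfun_add [rec_intros]:
  assumes "recfun a" "recfun b"
  shows "recfun (\<lambda>f x. a f x + b f x)"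
proof -
  have "rec_nat m (\<lambda>j r. Suc r) k = m + k" for m k
    by (induction k) auto
  moreover have "recfun (\<lambda>f x. rec_nat (a f x) (\<lambda>j r. Suc r) (b f x))"
    by (intro rec_intros assms)
  ultimately show ?thesis by simp
qed

lemma recfun_mult [rec_intros]:
  assumes "recfun a" "recfun b"
  shows "recfun (\<lambda>f x. a f x * b f x)"
proof -
  have "rec_nat 0 (\<lambda>j r. r + m) k = m * k" for m k :: nat
    by (induction k) auto
  moreover have "recfun (\<lambda>f x. rec_nat 0 (\<lambda>j r. r + a f x) (b f x))"
    by (intro rec_intros assms recfun_comp[OF assms(1)])
  ultimately show ?thesis by simp
qed

lemma recfun_diff [rec_intros]:
  assumes "recfun a" "recfun b"
  shows "recfun (\<lambda>f x. a f x - b f x)"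
proof -
  \<comment> \<open>A recursion may return its counter, which yields the truncated predecessor;
    iterating that gives truncated subtraction.\<close>
  have pred: "rec_nat 0 (\<lambda>j r. j) k = k - 1" for k :: nat
    by (cases k) auto
  have "recfun (\<lambda>f x. rec_nat 0 (\<lambda>j r. j) x)"
    by (intro rec_intros)
  then have *: "recfun (\<lambda>f x. x - 1)"
    unfolding pred .
  have "rec_nat m (\<lambda>j r. r - 1) k = m - k" for m k :: nat
    by (induction k) auto
  moreover have "recfun (\<lambda>f x. rec_nat (a f x) (\<lambda>j r. r - 1) (b f x))"
    by (intro recfun_rec_nat recfun_comp[OF *] rec_intros assms)
  ultimately show ?thesis by simp
qed

lemma recpred_Not [rec_intros]:
  assumes "recpred P"
  shows "recpred (\<lambda>f x. \<not> P f x)"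
proof -
  have "recfun (\<lambda>f x. if P f x then 0 else 1)"
    by (intro rec_intros assms)
  moreover have "(\<lambda>f x. if P f x then 0 else 1 :: nat) = (\<lambda>f x. if \<not> P f x then 1 else 0)"
    by (intro ext) simp
  ultimately show ?thesis by (simp add: recpred_def)
qed

lemma recpred_conj [rec_intros]:
  assumes "recpred P" "recpred Q"
  shows "recpred (\<lambda>f x. P f x \<and> Q f x)"
proof -
  have "recfun (\<lambda>f x. if P f x then if Q f x then 1 else 0 else 0)"
    by (intro rec_intros assms)
  moreover have "(\<lambda>f x. if P f x then if Q f x then 1 else 0 else 0 :: nat) =
      (\<lambda>f x. if P f x \<and> Q f x then 1 else 0)"
    by (intro ext) simp
  ultimately show ?thesis by (simp add: recpred_def)
qed

lemma recpred_disj [rec_intros]: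
  assumes "recpred P" "recpred Q"
  shows "recpred (\<lambda>f x. P f x \<or> Q f x)"
proof -
  have "recpred (\<lambda>f x. \<not> (\<not> P f x \<and> \<not> Q f x))"
    by (intro rec_intros assms)
  then show ?thesis by simp
qed

lemma recpred_imp [rec_intros]:
  assumes "recpred P" "recpred Q"
  shows "recpred (\<lambda>f x. P f x \<longrightarrow> Q f x)"
  unfolding imp_conv_disj by (intro rec_intros assms)

lemma recpred_le [rec_intros]:
  assumes "recfun a" "recfun b"
  shows "recpred (\<lambda>f x. a f x \<le> b f x)"
proof -
  have "recfun (\<lambda>f x. 1 - (a f x - b f x))"
    by (intro rec_intros assms)
  moreover have "(\<lambda>f x. 1 - (a f x - b f x)) = (\<lambda>f x. if a f x \<le> b f x then 1 else 0)"
    by (intro ext) auto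
  ultimately show ?thesis by (simp add: recpred_def)
qed

lemma recpred_less [rec_intros]:
  assumes "recfun a" "recfun b"
  shows "recpred (\<lambda>f x. a f x < b f x)"
  unfolding less_eq_Suc_le by (intro rec_intros assms)

lemma recpred_eq [rec_intros]:
  assumes "recfun a" "recfun b"
  shows "recpred (\<lambda>f x. a f x = b f x)"
  unfolding order_eq_iff by (intro rec_intros assms)

lemma recpred_Ex_less [rec_intros]:
  assumes "recpred (\<lambda>f z. P f (pfst z) (psnd z))" "recfun b"
  shows "recpred (\<lambda>f x. \<exists>y<b f x. P f x y)"
proof -
  have "rec_nat 0 (\<lambda>j r. if P f x j then 1 else r) k = (if \<exists>y<k. P f x y then 1 else 0 :: nat)"
    for f x k
    by (induction k) (auto simp: less_Suc_eq)
  moreover have "recpred (\<lambda>f z. P f (pfst z) (pfst (psnd z)))"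
    using recpred_comp[OF assms(1), of "\<lambda>f z. pair (pfst z) (pfst (psnd z))"]
    by (simp add: rec_intros)
  then have "recfun (\<lambda>f x. rec_nat 0 (\<lambda>j r. if P f x j then 1 else r) (b f x))"
    by (intro rec_intros assms)
  ultimately show ?thesis
    by (simp add: recpred_def)
qed

lemma recpred_All_less [rec_intros]:
  assumes "recpred (\<lambda>f z. P f (pfst z) (psnd z))" "recfun b"
  shows "recpred (\<lambda>f x. \<forall>y<b f x. P f x y)"
proof -
  have "recpred (\<lambda>f x. \<not> (\<exists>y<b f x. \<not> P f x y))"
    by (intro rec_intros assms)
  then show ?thesis by simp
qed

text \<open>This is the passage from decidable to semidecidable: the program halts exactly when a
  witness exists. The value 0 stands for truth here because \<open>Mu\<close> looks for a
  zero.\<close>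

lemma program_for_search:
  assumes "recpred (\<lambda>f z. P f (pfst z) (psnd z))"
  obtains p where
    "\<And>f x. run f p x = (if \<exists>m. P f x m then Some (LEAST m. P f x m) else None)"
proof -
  have "recfun (\<lambda>f z. if P f (pfst z) (psnd z) then 0 else 1)"
    by (intro rec_intros assms)
  then obtain p where p: "\<And>f z. run f p z = Some (if P f (pfst z) (psnd z) then 0 else 1)"
    unfolding recfun_def by blast
  have zero: "(P f x m \<and> (\<forall>j<m. \<not> P f x j)) = (m = (LEAST m. P f x m) \<and> P f x m)" for f x m
    using not_less_Least[of _ "P f x"] LeastI[of "P f x" m] Least_le[of "P f x" m]
    by (metis order_less_le)
  have "run f (Mu p) x = (if \<exists>m. P f x m then Some (LEAST m. P f x m) else None)" for f x
  proof -
    have "(\<exists>y>0. run f p (pair x j) = Some y) \<longleftrightarrow> \<not> P f x j"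
      and "run f p (pair x j) = Some 0 \<longleftrightarrow> P f x j" for j
      by (simp_all add: p)
    then have *: "(run f p (pair x m) = Some 0 \<and> (\<forall>j<m. \<exists>y>0. run f p (pair x j) = Some y))
        \<longleftrightarrow> m = (LEAST m. P f x m) \<and> P f x m" for m
      using zero[of f x m] by simp
    show ?thesis
      unfolding run.simps Let_def *
      by (auto intro: LeastI Least_equality)
  qed
  then show thesis by (rule that)
qed

lemma recfun_Least [rec_intros]:
  assumes "recpred (\<lambda>f z. P f (pfst z) (psnd z))" "\<And>f x. \<exists>m. P f x m"
  shows "recfun (\<lambda>f x. LEAST m. P f x m)"
proof -
  obtain p where "\<And>f x. run f p x = (if \<exists>m. P f x m then Some (LEAST m. P f x m) else None)"
    using program_for_search[OF assms(1)] by blast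
  then show ?thesis
    unfolding recfun_def using assms(2) by (intro exI[of _ p]) simp
qed

lemma recfun_div [rec_intros]:
  assumes "recfun a" "recfun b"
  shows "recfun (\<lambda>f x. a f x div b f x)"
proof -
  \<comment> \<open>The disjunct for divisor 0 keeps the search total and makes it return 0, as
    \<open>div\<close> does.\<close>
  have "recfun (\<lambda>f x. LEAST q. b f x = 0 \<or> a f x < b f x * Suc q)"
  proof (intro rec_intros)
    show "\<exists>q. b f x = 0 \<or> a f x < b f x * Suc q" for f x
      by (cases "b f x = 0") (auto intro: exI[of _ "a f x div b f x"] dividend_less_times_div)
  qed (rule assms[THEN recfun_comp] rec_intros)+
  moreover have "(LEAST q. n = 0 \<or> m < n * Suc q) = m div n" for m n :: nat
  proof (cases "n = 0")
    case False
    then have "n = 0 \<or> m < n * Suc q \<longleftrightarrow> m div n \<le> q" for q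
      by (simp add: less_mult_imp_div_less div_less_iff_less_mult mult.commute flip: less_Suc_eq_le)
    then show ?thesis by (simp add: Least_equality)
  qed (simp add: Least_equality)
  ultimately show ?thesis by simp
qed

lemma recfun_mod [rec_intros]:
  assumes "recfun a" "recfun b"
  shows "recfun (\<lambda>f x. a f x mod b f x)"
  unfolding minus_mult_div_eq_mod[symmetric] by (intro rec_intros assms)

lemma recfun_funpow [rec_intros]:
  assumes "recfun (\<lambda>f z. h f (pfst z) (psnd z))" "recfun k" "recfun a"
  shows "recfun (\<lambda>f x. ((\<lambda>y. h f x y) ^^ k f x) (a f x))"
proof -
  have "rec_nat y (\<lambda>j r. h f x r) m = ((\<lambda>y. h f x y) ^^ m) y" for f x y m
    by (induction m) auto
  moreover have "recfun (\<lambda>f z. h f (pfst z) (psnd (psnd z)))"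
    using recfun_comp[OF assms(1), of "\<lambda>f z. pair (pfst z) (psnd (psnd z))"]
    by (simp add: rec_intros)
  then have "recfun (\<lambda>f x. rec_nat (a f x) (\<lambda>j r. h f x r) (k f x))"
    by (intro rec_intros assms)
  ultimately show ?thesis by simp
qed

text \<open>The table of the first \<open>k\<close> values lists the latest value first.\<close>

definition look :: "nat \<Rightarrow> nat \<Rightarrow> nat" where
  "look t d = pfst (((\<lambda>y. psnd y) ^^ d) t)"

lemma look_simps [simp]: "look (pair v t) 0 = v" "look (pair v t) (Suc d) = look t d"
  by (simp_all add: look_def funpow_Suc_right del: funpow.simps(2))

lemma recfun_look [rec_intros]:
  "recfun t \<Longrightarrow> recfun d \<Longrightarrow> recfun (\<lambda>f x. look (t f x) (d f x))"
  unfolding look_def by (intro rec_intros)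

text \<open>Primitive recursion passes on only the last value, so the whole history is packed into
  one number. Value \<open>j\<close> then lies at depth \<open>k - Suc j\<close>, and
  \<open>G\<close> has to be right only on tables whose entries below \<open>k\<close> are
  right.\<close>

lemma recfun_course_of_values:
  assumes G: "recfun (\<lambda>f z. G f (pfst z) (pfst (psnd z)) (psnd (psnd z)))"
    and eq: "\<And>f x k t. (\<And>j. j < k \<Longrightarrow> look t (k - Suc j) = H f x j) \<Longrightarrow> G f x k t = H f x k"
    and "recfun k"
  shows "recfun (\<lambda>f x. H f x (k f x))"
proof -
  have table: "look (rec_nat 0 (\<lambda>j r. pair (G f x j r) r) m) (m - Suc j) = H f x j"
    if "j < m" for f x m j
    using that
  proof (induction m arbitrary: j)
    case (Suc m)
    let ?t = "\<lambda>m. rec_nat 0 (\<lambda>j r. pair (G f x j r) r) m"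
    show ?case
    proof (cases "j = m")
      case True
      then show ?thesis using eq[OF Suc.IH] by simp
    next
      case False
      then have "m - j = Suc (m - Suc j)" using Suc.prems by simp
      then show ?thesis using Suc.IH[of j] False Suc.prems by simp
    qed
  qed simp
  have "recfun (\<lambda>f x. look (rec_nat 0 (\<lambda>j r. pair (G f x j r) r) (Suc (k f x))) 0)"
    by (intro rec_intros G assms(3))
  moreover have "look (rec_nat 0 (\<lambda>j r. pair (G f x j r) r) (Suc m)) 0 = H f x m" for f x m
    using table[of m "Suc m" f x] by simp
  ultimately show ?thesis by (simp only:)
qed

section \<open>Oracle substitution\<close>

text \<open>
  The first component of the input is a parameter that is handed to every call of the program
  \<open>q\<close> answering the oracle questions.
\<close>

primrec oracle_subst :: "prog \<Rightarrow> prog \<Rightarrow> prog" where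
  "oracle_subst q Zero = Zero"
| "oracle_subst q Succ = Comp Succ Snd"
| "oracle_subst q Fst = Comp Fst Snd"
| "oracle_subst q Snd = Comp Snd Snd"
| "oracle_subst q Oracle = q"
| "oracle_subst q (Tup p r) = Tup (oracle_subst q p) (oracle_subst q r)"
| "oracle_subst q (Comp p r) = Comp (oracle_subst q p) (Tup Fst (oracle_subst q r))"
| "oracle_subst q (Prec p r) =
     Comp
       (Prec (oracle_subst q p)
         (Comp (oracle_subst q r) (Tup (Comp Fst Fst) (Tup (Comp Snd Fst) Snd))))
       (Tup (Tup Fst (Comp Fst Snd)) (Comp Snd Snd))"
| "oracle_subst q (Mu p) =
     Mu (Comp (oracle_subst q p) (Tup (Comp Fst Fst) (Tup (Comp Snd Fst) Snd)))"

text \<open>The equation is between options, so divergence of \<open>p\<close> is transported as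
  well; preimages at level 0 rest on this.\<close>

lemma run_oracle_subst:
  assumes q: "\<And>k. run f q (pair a k) = Some (g k)"
  shows "run f (oracle_subst q p) (pair a x) = run g p x"
proof (induction p arbitrary: x)
  case (Prec p r)
  show ?case by (simp add: Prec split: prod.split)
qed (simp_all add: q)

section \<open>A universal program\<close>

text \<open>
  \<open>run_on f D\<close> gives up as soon as a subprogram is started on an input outside \<open>D\<close>. Since this
  includes \<^const>\<open>Oracle\<close>, only the values of \<open>f\<close> on \<open>D\<close> matter.
\<close>

primrec run_on :: "(nat \<Rightarrow> nat) \<Rightarrow> nat set \<Rightarrow> prog \<Rightarrow> nat \<Rightarrow> nat option" where
  "run_on f D Zero x = (if x \<in> D then Some 0 else None)"
| "run_on f D Succ x = (if x \<in> D then Some (Suc x) else None)"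
| "run_on f D Fst x = (if x \<in> D then Some (pfst x) else None)"
| "run_on f D Snd x = (if x \<in> D then Some (psnd x) else None)"
| "run_on f D Oracle x = (if x \<in> D then Some (f x) else None)"
| "run_on f D (Tup p q) x =
     (if x \<in> D then
       Option.bind (run_on f D p x) (\<lambda>a. Option.bind (run_on f D q x) (\<lambda>b. Some (pair a b)))
      else None)"
| "run_on f D (Comp p q) x =
     (if x \<in> D then Option.bind (run_on f D q x) (run_on f D p) else None)"
| "run_on f D (Prec p q) x =
     (if x \<in> D then
       rec_nat (run_on f D p (pfst x))
         (\<lambda>j r. Option.bind r (\<lambda>y. run_on f D q (pair (pfst x) (pair j y)))) (psnd x)
      else None)"
| "run_on f D (Mu p) x =
     (if x \<in> D then
       (let zero_at = (\<lambda>m. run_on f D p (pair x m) = Some 0 \<and>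
                           (\<forall>j<m. \<exists>y>0. run_on f D p (pair x j) = Some y))
        in if \<exists>m. zero_at m then Some (LEAST m. zero_at m) else None)
      else None)"

section \<open>Monotonicity and finite use of guarded computations\<close>

lemma run_on_UNIV: "run_on f UNIV p x = run f p x"
proof (induction p arbitrary: x)
  case (Prec p q)
  then show ?case by (simp add: case_prod_beta)
qed (simp_all cong: Option.bind_cong)

lemma run_on_outside: "x \<notin> D \<Longrightarrow> run_on f D p x = None"
  by (cases p) simp_all

lemma run_on_cong:
  assumes "\<And>k. k \<in> D \<Longrightarrow> f k = g k"
  shows "run_on f D p x = run_on g D p x"
  by (induction p arbitrary: x) (simp_all add: assms cong: Option.bind_cong)

text \<open>Of two such positions, the larger would require a positive value at the smaller. This
  uniqueness is why minimization is monotone in the guard: enlarging it cannot reveal an earlier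
  zero.\<close>

lemma Least_first_zero:
  fixes v :: "nat \<Rightarrow> nat option"
  assumes "v m = Some 0 \<and> (\<forall>j<m. \<exists>y>0. v j = Some y)"
  shows "(LEAST m. v m = Some 0 \<and> (\<forall>j<m. \<exists>y>0. v j = Some y)) = m"
  using assms by (intro Least_equality) (auto simp: not_less[symmetric])

lemma run_on_mono:
  assumes "D \<subseteq> E" "run_on f D p x = Some y"
  shows "run_on f E p x = Some y"
  using assms(2)
proof (induction p arbitrary: x y)
  case (Tup p q)
  then show ?case using assms(1) by (auto split: if_splits simp: bind_eq_Some_conv)
next
  case (Comp p q)
  then show ?case using assms(1) by (auto split: if_splits simp: bind_eq_Some_conv)
next
  case (Prec p q)
  have "rec_nat (run_on f D p a)
      (\<lambda>j r. Option.bind r (\<lambda>y. run_on f D q (pair a (pair j y)))) k = Some z \<Longrightarrow>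
    rec_nat (run_on f E p a)
      (\<lambda>j r. Option.bind r (\<lambda>y. run_on f E q (pair a (pair j y)))) k = Some z" for a k z
    by (induction k arbitrary: z) (auto simp: Prec.IH bind_eq_Some_conv)
  then show ?case using Prec.prems assms(1) by (auto split: if_splits)
next
  case (Mu p)
  let ?zero_at = "\<lambda>D m. run_on f D p (pair x m) = Some 0 \<and>
    (\<forall>j<m. \<exists>y>0. run_on f D p (pair x j) = Some y)"
  have x: "x \<in> D" and ex: "\<exists>m. ?zero_at D m" and y: "y = (LEAST m. ?zero_at D m)"
    using Mu.prems by (auto simp: Let_def split: if_splits)
  obtain m where m: "?zero_at D m"
    using ex by blast
  then have "?zero_at E m"
    using Mu.IH by blast
  moreover have "y = m"
    unfolding y by (rule Least_first_zero[OF m])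
  ultimately have "?zero_at E y"
    by simp
  then show ?case
    using x assms(1) Least_first_zero[of "\<lambda>m. run_on f E p (pair x m)" y]
    by (auto simp: Let_def)
qed (use assms(1) in \<open>auto split: if_splits\<close>)

lemma run_on_lessThan_mono:
  "s \<le> t \<Longrightarrow> run_on f {..<s} p x = Some y \<Longrightarrow> run_on f {..<t} p x = Some y"
  by (rule run_on_mono[of "{..<s}"]) auto

lemma run_on_sound: "run_on f D p x = Some y \<Longrightarrow> run f p x = Some y"
  using run_on_mono[of D UNIV] by (simp add: run_on_UNIV)

text \<open>Meant for \<open>Mu\<close>: the values below the zero converge under bounds of their
  own, and a common bound is needed.\<close>

lemma ex_uniform_bound:
  fixes P :: "nat \<Rightarrow> nat \<Rightarrow> bool"
  assumes "\<And>j s t. P j s \<Longrightarrow> s \<le> t \<Longrightarrow> P j t" "\<And>j. j < m \<Longrightarrow> \<exists>s. P j s"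
  shows "\<exists>s. \<forall>j<m. P j s"
  using assms(2)
proof (induction m)
  case (Suc m)
  then obtain s t where "\<forall>j<m. P j s" "P m t" by (meson less_Suc_eq)
  then have "\<forall>j<Suc m. P j (max s t)"
    using assms(1) by (auto simp: less_Suc_eq)
  then show ?case by blast
qed simp

text \<open>A halting computation starts subprograms on finitely many inputs only, and any
  \<open>s\<close> above all of them works. The recurring \<open>Suc x\<close> admits the outermost
  input.\<close>

lemma run_on_complete:
  "run f p x = Some y \<Longrightarrow> \<exists>s. run_on f {..<s} p x = Some y"
proof (induction p arbitrary: x y)
  case (Tup p q)
  then obtain a b where ab: "run f p x = Some a" "run f q x = Some b" "y = pair a b"
    by (auto simp: bind_eq_Some_conv)
  then obtain s t where "run_on f {..<s} p x = Some a" "run_on f {..<t} q x = Some b"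
    using Tup.IH by blast
  then have "run_on f {..<max (Suc x) (max s t)} p x = Some a"
    "run_on f {..<max (Suc x) (max s t)} q x = Some b"
    by (auto elim!: run_on_lessThan_mono[rotated])
  then show ?case using ab(3)
    by (intro exI[of _ "max (Suc x) (max s t)"]) simp
next
  case (Comp p q)
  then obtain a where a: "run f q x = Some a" "run f p a = Some y"
    by (auto simp: bind_eq_Some_conv)
  then obtain s t where "run_on f {..<s} q x = Some a" "run_on f {..<t} p a = Some y"
    using Comp.IH by blast
  then have "run_on f {..<max (Suc x) (max s t)} q x = Some a"
    "run_on f {..<max (Suc x) (max s t)} p a = Some y"
    by (auto elim!: run_on_lessThan_mono[rotated])
  then show ?case
    by (intro exI[of _ "max (Suc x) (max s t)"]) simp
next
  case (Prec p q)
  define loop where "loop D k = rec_nat (run_on f D p (pfst x))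
      (\<lambda>j r. Option.bind r (\<lambda>y. run_on f D q (pair (pfst x) (pair j y)))) k" for D k
  have mono: "loop {..<t} k = Some z" if "s \<le> t" "loop {..<s} k = Some z" for s t k z
    using that(2)
    by (induction k arbitrary: z)
      (auto simp: loop_def bind_eq_Some_conv intro: run_on_lessThan_mono[OF that(1)])
  have "\<exists>s. loop {..<s} k = Some z" if "loop UNIV k = Some z" for k z
    using that
  proof (induction k arbitrary: z)
    case 0
    then show ?case using Prec.IH(1) by (auto simp: loop_def run_on_UNIV)
  next
    case (Suc k)
    then obtain w where w: "loop UNIV k = Some w"
      "run f q (pair (pfst x) (pair k w)) = Some z"
      by (auto simp: loop_def run_on_UNIV bind_eq_Some_conv)
    then obtain s t where "loop {..<s} k = Some w"
      "run_on f {..<t} q (pair (pfst x) (pair k w)) = Some z"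
      using Suc.IH Prec.IH(2) by blast
    then have "loop {..<max s t} k = Some w"
      "run_on f {..<max s t} q (pair (pfst x) (pair k w)) = Some z"
      using mono[of s "max s t"] run_on_lessThan_mono[of t "max s t"] by auto
    then show ?case
      by (intro exI[of _ "max s t"]) (simp add: loop_def)
  qed
  moreover have "loop UNIV (psnd x) = Some y"
    using Prec.prems by (simp add: loop_def run_on_UNIV case_prod_beta)
  ultimately obtain s where "loop {..<s} (psnd x) = Some y"
    by blast
  then have "loop {..<max (Suc x) s} (psnd x) = Some y"
    using mono[of s "max (Suc x) s"] by simp
  then show ?case
    by (intro exI[of _ "max (Suc x) s"]) (simp add: loop_def)
next
  case (Mu p)
  let ?zero_at = "\<lambda>m. run f p (pair x m) = Some 0 \<and>
    (\<forall>j<m. \<exists>y>0. run f p (pair x j) = Some y)"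
  have ex: "\<exists>m. ?zero_at m" and y: "y = (LEAST m. ?zero_at m)"
    using Mu.prems by (auto simp: Let_def split: if_splits)
  obtain m where m: "?zero_at m"
    using ex by blast
  have "y = m"
    unfolding y by (rule Least_first_zero[OF m])
  then have y: "?zero_at y"
    using m by simp
  have "\<exists>s. \<forall>j<y. \<exists>z>0. run_on f {..<s} p (pair x j) = Some z"
  proof (rule ex_uniform_bound)
    show "\<exists>s. \<exists>z>0. run_on f {..<s} p (pair x j) = Some z" if "j < y" for j
      using y that Mu.IH by meson
  qed (use run_on_lessThan_mono in blast)
  then obtain s where s: "\<forall>j<y. \<exists>z>0. run_on f {..<s} p (pair x j) = Some z"
    by blast
  obtain t where t: "run_on f {..<t} p (pair x y) = Some 0"
    using y Mu.IH by blast
  define u where "u = max (Suc x) (max s t)"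
  have "run_on f {..<u} p (pair x y) = Some 0 \<and>
      (\<forall>j<y. \<exists>z>0. run_on f {..<u} p (pair x j) = Some z)"
    using s t run_on_lessThan_mono[of s u f p] run_on_lessThan_mono[of t u f p]
    by (fastforce simp: u_def)
  moreover from this have "(LEAST m. run_on f {..<u} p (pair x m) = Some 0 \<and>
      (\<forall>j<m. \<exists>z>0. run_on f {..<u} p (pair x j) = Some z)) = y"
    by (rule Least_first_zero)
  moreover have "x \<in> {..<u}"
    by (simp add: u_def)
  ultimately have "run_on f {..<u} (Mu p) x = Some y"
    by (auto simp: Let_def)
  then show ?case by blast
qed (auto intro: exI[of _ "Suc _"])

text \<open>Halting becomes an existential quantifier over stages \<open>s\<close>, each of which
  consults only the first \<open>s\<close> values of the oracle.\<close>

lemma run_eq_Some_iff: "run f p x = Some y \<longleftrightarrow> (\<exists>s. run_on f {..<s} p x = Some y)"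
  using run_on_complete run_on_sound by blast

lemma run_neq_None_iff: "run f p x \<noteq> None \<longleftrightarrow> (\<exists>s. run_on f {..<s} p x \<noteq> None)"
  using run_eq_Some_iff[of f p x] by auto

text \<open>
  Results of a guarded computation are coded by \<open>0\<close> for divergence and \<open>Suc y\<close> for \<open>Some y\<close>. For
  the bound \<open>s\<close>, the result of program \<open>i\<close> on \<open>y < s\<close> is entry \<open>i * s + y\<close> of a table; the entries
  needed to compute an entry precede it, because codes of subprograms are smaller.
\<close>

abbreviation outcome :: "nat option \<Rightarrow> nat" where
  "outcome \<equiv> case_option 0 Suc"

text \<open>The guard keeps the address \<open>i * s + y\<close> inside the row of program
  \<open>i\<close>; the default 0 is the code of divergence, which is the outcome outside the
  bound.\<close>

definition entry :: "nat \<Rightarrow> nat \<Rightarrow> nat \<Rightarrow> nat \<Rightarrow> nat \<Rightarrow> nat" where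
  "entry s k t i y = (if y < s then look t (k - Suc (i * s + y)) else 0)"

lemma recfun_entry [rec_intros]:
  assumes "recfun s" "recfun k" "recfun t" "recfun i" "recfun y"
  shows "recfun (\<lambda>f x. entry (s f x) (k f x) (t f x) (i f x) (y f x))"
  unfolding entry_def by (intro rec_intros assms)

text \<open>Row \<open>k div s\<close> is the program code, column \<open>k mod s\<close> the input,
  and \<open>- 1\<close> undoes the coding of outcomes. For \<open>s = 0\<close> the outer test
  fails. In the search, the alternative \<open>s \<le> m\<close> makes the \<open>LEAST\<close>
  total, as \<open>recfun_Least\<close> requires.\<close>

definition next_entry :: "(nat \<Rightarrow> nat) \<Rightarrow> nat \<Rightarrow> nat \<Rightarrow> nat \<Rightarrow> nat" where
  "next_entry f s k t =
    (if k mod s < s then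
      if k div s mod 9 = 0 then 1
      else if k div s mod 9 = 1 then Suc (Suc (k mod s))
      else if k div s mod 9 = 2 then Suc (pfst (k mod s))
      else if k div s mod 9 = 3 then Suc (psnd (k mod s))
      else if k div s mod 9 = 4 then Suc (f (k mod s))
      else if k div s mod 9 = 5 then
        (if entry s k t (pfst (k div s div 9)) (k mod s) = 0
            \<or> entry s k t (psnd (k div s div 9)) (k mod s) = 0 then 0
         else Suc (pair (entry s k t (pfst (k div s div 9)) (k mod s) - 1)
                     (entry s k t (psnd (k div s div 9)) (k mod s) - 1)))
      else if k div s mod 9 = 6 then
        (if entry s k t (psnd (k div s div 9)) (k mod s) = 0 then 0
         else entry s k t (pfst (k div s div 9))
                (entry s k t (psnd (k div s div 9)) (k mod s) - 1))
      else if k div s mod 9 = 7 then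
        rec_nat (entry s k t (pfst (k div s div 9)) (pfst (k mod s)))
          (\<lambda>j r. if r = 0 then 0
                 else entry s k t (psnd (k div s div 9)) (pair (pfst (k mod s)) (pair j (r - 1))))
          (psnd (k mod s))
      else
        (if \<exists>m<s. entry s k t (k div s div 9) (pair (k mod s) m) = 1 \<and>
              (\<forall>j<m. 1 < entry s k t (k div s div 9) (pair (k mod s) j))
         then Suc (LEAST m. s \<le> m \<or> entry s k t (k div s div 9) (pair (k mod s) m) = 1 \<and>
                (\<forall>j<m. 1 < entry s k t (k div s div 9) (pair (k mod s) j)))
         else 0)
     else 0)"

lemma recfun_next_entry:
  assumes "recfun s" "recfun k" "recfun t"
  shows "recfun (\<lambda>f x. next_entry f (s f x) (k f x) (t f x))"
proof -
  note comps = assms[THEN recfun_comp]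
  show ?thesis
    unfolding next_entry_def
    by (intro rec_intros assms comps) auto
qed

lemma outcome_eq:
  "outcome r = 0 \<longleftrightarrow> r = None" "outcome r = Suc y \<longleftrightarrow> r = Some y"
  "Suc 0 < outcome r \<longleftrightarrow> (\<exists>y>0. r = Some y)"
  by (auto split: option.split)

lemma next_entry_correct:
  assumes "\<And>j. j < k \<Longrightarrow> look t (k - Suc j) = outcome (run_on f {..<s} (prog_of (j div s)) (j mod s))"
  shows "next_entry f s k t = outcome (run_on f {..<s} (prog_of (k div s)) (k mod s))"
proof (cases "k mod s < s")
  case False
  then show ?thesis by (simp add: next_entry_def run_on_outside)
next
  case True
  define e x where "e = k div s" and "x = k mod s"
  have "0 < s" "x < s"
    using True by (auto simp: x_def)
  have entry: "entry s k t i y = outcome (run_on f {..<s} (prog_of i) y)" if "i < e" for i y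
  proof (cases "y < s")
    case y: True
    have "i * s + y < Suc i * s"
      using y by simp
    also have "\<dots> \<le> e * s"
      using that by (intro mult_le_mono1) simp
    also have "\<dots> \<le> k"
      by (simp add: e_def)
    finally have "i * s + y < k" .
    then show ?thesis
      using assms[of "i * s + y"] y by (simp add: entry_def)
  qed (simp add: entry_def run_on_outside)
  \<comment> \<open>Codes of subprograms are bounded by the quotient by 9, which is smaller than
    \<open>e\<close> only for nonzero \<open>e\<close>; the residues 5 to 8 exclude 0.\<close>
  have sub: "pfst (e div 9) < e" "psnd (e div 9) < e" "e div 9 < e" if "e \<noteq> 0"
    using that prod_decode_div_less[of e 9] by auto
  have "e mod 9 = 0 \<or> e mod 9 = 1 \<or> e mod 9 = 2 \<or> e mod 9 = 3 \<or> e mod 9 = 4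
      \<or> e mod 9 = 5 \<or> e mod 9 = 6 \<or> e mod 9 = 7 \<or> e mod 9 = 8"
    by presburger
  then consider "e mod 9 = 0" | "e mod 9 = 1" | "e mod 9 = 2" | "e mod 9 = 3" | "e mod 9 = 4"
    | "e mod 9 = 5" | "e mod 9 = 6" | "e mod 9 = 7" | "e mod 9 = 8"
    by (elim disjE) simp_all
  then show ?thesis
  proof cases
    case 6
    then have "e \<noteq> 0" by auto
    with 6 \<open>x < s\<close> show ?thesis
      unfolding next_entry_def e_def[symmetric] x_def[symmetric]
      by (subst prog_of.simps) (auto simp: entry sub outcome_eq Let_def split: option.split)
  next
    case 7
    then have "e \<noteq> 0" by auto
    with 7 \<open>x < s\<close> show ?thesis
      unfolding next_entry_def e_def[symmetric] x_def[symmetric]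
      by (subst prog_of.simps) (auto simp: entry sub outcome_eq Let_def split: option.split)
  next
    case 8
    then have "e \<noteq> 0" by auto
    let ?a = "pfst (e div 9)" and ?b = "psnd (e div 9)"
    have "rec_nat (entry s k t ?a (pfst x))
        (\<lambda>j r. if r = 0 then 0 else entry s k t ?b (pair (pfst x) (pair j (r - 1)))) m =
      outcome (rec_nat (run_on f {..<s} (prog_of ?a) (pfst x))
        (\<lambda>j r. Option.bind r (\<lambda>y. run_on f {..<s} (prog_of ?b) (pair (pfst x) (pair j y)))) m)"
      for m
      by (induction m) (auto simp: entry sub \<open>e \<noteq> 0\<close> split: option.splits)
    with 8 \<open>x < s\<close> show ?thesis
      unfolding next_entry_def e_def[symmetric] x_def[symmetric]
      by (subst prog_of.simps) (simp add: Let_def)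
  next
    case 9
    then have "e \<noteq> 0" by auto
    define zero_at where "zero_at m \<longleftrightarrow> run_on f {..<s} (prog_of (e div 9)) (pair x m) = Some 0 \<and>
      (\<forall>j<m. \<exists>y>0. run_on f {..<s} (prog_of (e div 9)) (pair x j) = Some y)" for m
    have entry_zero: "entry s k t (e div 9) (pair x m) = 1 \<and>
        (\<forall>j<m. 1 < entry s k t (e div 9) (pair x j)) \<longleftrightarrow> zero_at m" for m
      by (simp add: zero_at_def entry sub \<open>e \<noteq> 0\<close> outcome_eq)
    \<comment> \<open>The guard admits only inputs \<open>pair x m\<close> below \<open>s\<close>,
      so a search bounded by \<open>s\<close> misses no zero.\<close>
    have bound: "m < s" if "zero_at m" for m
    proof -
      have "pair x m < s"
        using that run_on_outside[of "pair x m" "{..<s}" f "prog_of (e div 9)"]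
        by (auto simp: zero_at_def)
      then show ?thesis
        using le_prod_encode_2[of m x] by simp
    qed
    have "(LEAST m. s \<le> m \<or> zero_at m) = (LEAST m. zero_at m)" if "zero_at n" for n
    proof (rule Least_equality)
      show "s \<le> (LEAST m. zero_at m) \<or> zero_at (LEAST m. zero_at m)"
        using that by (blast intro: LeastI)
      show "(LEAST m. zero_at m) \<le> m" if "s \<le> m \<or> zero_at m" for m
        using that Least_le[of zero_at] bound[OF \<open>zero_at n\<close>] \<open>zero_at n\<close>
        by (meson le_less_trans linear not_less)
    qed
    moreover have "prog_of e = Mu (prog_of (e div 9))"
      using 9 by (subst prog_of.simps) (simp add: Let_def)
    then have "run_on f {..<s} (prog_of e) x =
        (if \<exists>m. zero_at m then Some (LEAST m. zero_at m) else None)"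
      using \<open>x < s\<close> unfolding zero_at_def by (auto simp: Let_def)
    ultimately show ?thesis
      using 9 \<open>x < s\<close> bound
      unfolding next_entry_def e_def[symmetric] x_def[symmetric] entry_zero
      by auto
  qed (use \<open>x < s\<close> in \<open>simp add: next_entry_def e_def[symmetric] x_def[symmetric] prog_of.simps[of e] Let_def\<close>)+
qed

lemma recfun_outcome_run_on:
  assumes "recfun s" "recfun e" "recfun y"
  shows "recfun (\<lambda>f x. outcome (run_on f {..<s f x} (prog_of (e f x)) (y f x)))"
proof -
  have "recfun (\<lambda>f x. outcome (run_on f {..<s f x} (prog_of ((e f x * s f x + y f x) div s f x))
      ((e f x * s f x + y f x) mod s f x)))"
    by (rule recfun_course_of_values[where G = "\<lambda>f x k t. next_entry f (s f x) k t" and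
          H = "\<lambda>f x k. outcome (run_on f {..<s f x} (prog_of (k div s f x)) (k mod s f x))",
          OF _ next_entry_correct])
      (assumption | intro rec_intros recfun_next_entry recfun_comp[OF assms(1)] assms)+
  \<comment> \<open>The address decodes to \<open>e\<close> and \<open>y\<close> only when
    \<open>y < s\<close>; otherwise the code of divergence is supplied separately.\<close>
  then have "recfun (\<lambda>f x. if y f x < s f x then
      outcome (run_on f {..<s f x} (prog_of ((e f x * s f x + y f x) div s f x))
        ((e f x * s f x + y f x) mod s f x)) else 0)"
    by (intro rec_intros assms)
  moreover have "(if y < s then
      outcome (run_on f {..<s} (prog_of ((e * s + y) div s)) ((e * s + y) mod s)) else 0) =
    outcome (run_on f {..<s} (prog_of e) y)" for f s e y
    by (auto simp: run_on_outside)
  ultimately show ?thesis by (simp only:)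
qed

lemma recpred_run_on [rec_intros]:
  assumes "recfun s" "recfun e" "recfun y"
  shows "recpred (\<lambda>f x. run_on f {..<s f x} (prog_of (e f x)) (y f x) \<noteq> None)"
proof -
  have "recpred (\<lambda>f x. \<not> outcome (run_on f {..<s f x} (prog_of (e f x)) (y f x)) = 0)"
    by (intro rec_intros recfun_outcome_run_on assms)
  then show ?thesis by (simp add: outcome_eq)
qed

text \<open>Search for a stage at which the guarded run converges, then read off its outcome;
  soundness of guarded runs makes that value the right one.\<close>

lemma universal_program:
  obtains U where "\<And>f e x. run f U (pair e x) = run f (prog_of e) x"
proof -
  have "recpred (\<lambda>f z. run_on f {..<psnd z} (prog_of (pfst (pfst z))) (psnd (pfst z)) \<noteq> None)"
    by (intro rec_intros)
  from program_for_search[of "\<lambda>f z s. run_on f {..<s} (prog_of (pfst z)) (psnd z) \<noteq> None", OF this]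
  obtain p where p: "\<And>f z. run f p z =
      (if \<exists>s. run_on f {..<s} (prog_of (pfst z)) (psnd z) \<noteq> None
       then Some (LEAST s. run_on f {..<s} (prog_of (pfst z)) (psnd z) \<noteq> None) else None)"
    by blast
  have "recfun (\<lambda>f z. outcome (run_on f {..<psnd z} (prog_of (pfst (pfst z))) (psnd (pfst z))) - 1)"
    by (intro rec_intros recfun_outcome_run_on)
  then obtain q where q: "\<And>f z. run f q z =
      Some (outcome (run_on f {..<psnd z} (prog_of (pfst (pfst z))) (psnd (pfst z))) - 1)"
    unfolding recfun_def by blast
  \<comment> \<open>\<open>Tup Fst Snd\<close> is the identity, so \<open>q\<close> receives the
    input together with the stage found by \<open>p\<close>.\<close>
  have "run f (Comp q (Tup (Tup Fst Snd) p)) (pair e x) = run f (prog_of e) x" for f e x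
  proof (cases "\<exists>s. run_on f {..<s} (prog_of e) x \<noteq> None")
    case True
    then have "run_on f {..<LEAST s. run_on f {..<s} (prog_of e) x \<noteq> None} (prog_of e) x \<noteq> None"
      by (rule LeastI_ex)
    then obtain y where
      "run_on f {..<LEAST s. run_on f {..<s} (prog_of e) x \<noteq> None} (prog_of e) x = Some y"
      by blast
    with True run_on_sound[OF this] show ?thesis
      by (simp add: p q del: not_None_eq)
  next
    case False
    with run_neq_None_iff[of f "prog_of e" x] show ?thesis
      by (simp add: p)
  qed
  then show thesis by (rule that)
qed

text \<open>The new oracle may depend on the input, which is therefore duplicated: once as the
  parameter of the oracle answers, once as the argument.\<close>

lemma recfun_oracle_subst:
  assumes "recfun F" "recfun (\<lambda>f z. g f (pfst z) (psnd z))"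
  shows "recfun (\<lambda>f x. F (\<lambda>k. g f x k) x)"
proof -
  obtain p q where "\<And>f x. run f p x = Some (F f x)"
    and q: "\<And>f z. run f q z = Some (g f (pfst z) (psnd z))"
    using assms unfolding recfun_def by blast
  moreover have "run f (oracle_subst q p) (pair x x) = run (g f x) p x" for f x
    by (rule run_oracle_subst) (simp add: q)
  ultimately show ?thesis
    unfolding recfun_def
    by (intro exI[of _ "Comp (oracle_subst q p) (Tup (Tup Fst Snd) (Tup Fst Snd))"]) simp
qed

lemma recpred_oracle_subst:
  assumes "recpred P" "recfun (\<lambda>f z. g f (pfst z) (psnd z))"
  shows "recpred (\<lambda>f x. P (\<lambda>k. g f x k) x)"
  using recfun_oracle_subst[OF assms(1)[unfolded recpred_def] assms(2)] by (simp add: recpred_def)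

text \<open>Answering all oracle questions by \<open>Zero\<close> turns a program run with the zero
  oracle into one that ignores its oracle.\<close>

lemma computable_iff_recfun: "computable u \<longleftrightarrow> recfun (\<lambda>f. u)"
proof
  assume "computable u"
  then obtain e where "run (\<lambda>_. 0) (prog_of e) x = Some (u x)" for x
    unfolding computable_def Phi_def by blast
  then have "run f (Comp (oracle_subst Zero (prog_of e)) (Tup Zero (Tup Fst Snd))) x = Some (u x)"
    for f x
    using run_oracle_subst[of f Zero 0 "\<lambda>_. 0" "prog_of e" x] by simp
  then show "recfun (\<lambda>f. u)"
    unfolding recfun_def by blast
next
  assume "recfun (\<lambda>f. u)"
  then obtain p where "\<And>f x. run f p x = Some (u x)"
    unfolding recfun_def by blast
  moreover obtain e where "prog_of e = p"
    using surj_prog_of by (metis surjD)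
  ultimately show "computable u"
    unfolding computable_def Phi_def by blast
qed

section \<open>Computable operations on program codes\<close>

lemma recfun_comp_computable:
  "recfun (\<lambda>f. u) \<Longrightarrow> recfun a \<Longrightarrow> recfun (\<lambda>f x. u (a f x))"
  by (rule recfun_comp[where F = "\<lambda>f. u"])

lemma prog_of_Tup: "prog_of (9 * pair a b + 5) = Tup (prog_of a) (prog_of b)"
proof -
  have "(9 * pair a b + 5) div 9 = pair a b" "(9 * pair a b + 5) mod 9 = 5"
    by simp_all
  then show ?thesis by (subst prog_of.simps) (simp add: Let_def)
qed

lemma prog_of_Comp: "prog_of (9 * pair a b + 6) = Comp (prog_of a) (prog_of b)"
proof -
  have "(9 * pair a b + 6) div 9 = pair a b" "(9 * pair a b + 6) mod 9 = 6"
    by simp_all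
  then show ?thesis by (subst prog_of.simps) (simp add: Let_def)
qed

lemma smn:
  obtains c where "recfun (\<lambda>f. c)" "\<And>f i x. run f (prog_of (c i)) x = run f p (pair i x)"
proof -
  obtain a b where a: "prog_of a = p" and b: "prog_of b = Tup Fst Snd"
    using surj_prog_of by (metis surjD)
  \<comment> \<open>0 codes \<open>Zero\<close>, 1 codes \<open>Succ\<close> and residue 6 codes
    \<open>Comp\<close>, so this is the code of \<open>Succ\<close> composed \<open>i\<close> times
    onto \<open>Zero\<close>.\<close>
  define const where "const i = rec_nat 0 (\<lambda>j r. 9 * pair 1 r + 6) i" for i :: nat
  define c where "c i = 9 * pair a (9 * pair (const i) b + 5) + 6" for i
  have "run f (prog_of (const i)) x = Some i" for f i x
  proof (induction i)
    case 0
    show ?case by (simp add: const_def prog_of.simps[of 0])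
  next
    case (Suc i)
    have "prog_of 1 = Succ"
      by (subst prog_of.simps) simp
    then have "prog_of (const (Suc i)) = Comp Succ (prog_of (const i))"
      unfolding const_def by (simp add: prog_of_Comp)
    then show ?case using Suc by simp
  qed
  then have "run f (prog_of (c i)) x = run f p (pair i x)" for f i x
    unfolding c_def prog_of_Comp prog_of_Tup by (simp add: a b)
  moreover have "recfun (\<lambda>f. c)"
    unfolding c_def const_def by (intro rec_intros)
  ultimately show thesis using that by blast
qed

section \<open>Finite Boolean combinations of cylinders\<close>

text \<open>Iterated tail on list codes: a nonempty list has code \<open>Suc (pair x t)\<close> with
  \<open>t\<close> the code of its tail, and the code 0 of the empty list is a fixed point because
  \<open>psnd 0 = 0\<close>.\<close>

definition code_drop :: "nat \<Rightarrow> nat \<Rightarrow> nat" where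
  "code_drop m k = ((\<lambda>y. psnd (y - 1)) ^^ k) m"

lemma recfun_code_drop [rec_intros]:
  "recfun a \<Longrightarrow> recfun b \<Longrightarrow> recfun (\<lambda>f x. code_drop (a f x) (b f x))"
  unfolding code_drop_def by (intro rec_intros)

lemma code_drop_list_encode:
  "(code_drop (list_encode xs) k \<noteq> 0 \<longleftrightarrow> k < length xs) \<and>
    (k < length xs \<longrightarrow> pfst (code_drop (list_encode xs) k - 1) = xs ! k)"
proof (induction xs arbitrary: k)
  case Nil
  have "psnd 0 = 0"
    using prod_decode_bounds(2)[of 0] by simp
  then have "((\<lambda>y. psnd (y - 1)) ^^ k) 0 = 0" for k
    by (induction k) auto
  then show ?case
    by (simp add: code_drop_def)
next
  case (Cons x xs)
  have "code_drop (list_encode (x # xs)) (Suc k) = code_drop (list_encode xs) k" for k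
    by (simp add: code_drop_def funpow_Suc_right del: funpow.simps(2))
  moreover have "code_drop (list_encode (x # xs)) 0 = Suc (pair x (list_encode xs))"
    by (simp add: code_drop_def)
  ultimately show ?case
    using Cons.IH by (cases k) (simp_all del: list_encode.simps)
qed

lemma length_le_list_encode: "length xs \<le> list_encode xs"
proof (induction xs)
  case (Cons x xs)
  then show ?case using le_prod_encode_2[of "list_encode xs" x] by simp
qed simp

text \<open>A list is no longer than its code, so the quantifier over positions can be bounded by
  \<open>m\<close> and membership is decidable.\<close>

lemma mem_cylinder_iff:
  "f \<in> cylinder (list_decode m) \<longleftrightarrow>
    (\<forall>k<m. code_drop m k \<noteq> 0 \<longrightarrow> f k = pfst (code_drop m k - 1))"
  using code_drop_list_encode[where xs = "list_decode m"] length_le_list_encode[of "list_decode m"]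
  by (auto simp: cylinder_def)

lemma recpred_Pi_class_0:
  assumes "recfun a"
  shows "recpred (\<lambda>f x. f \<in> Pi_class 0 (a f x))"
proof -
  \<comment> \<open>On characteristic values, complement is subtraction from 1 and intersection is
    multiplication.\<close>
  define G where "G f k t =
    (if k mod 3 = 0 then
      if \<forall>i<k div 3. code_drop (k div 3) i \<noteq> 0 \<longrightarrow> f i = pfst (code_drop (k div 3) i - 1)
      then 1 else 0
    else if k mod 3 = 1 then 1 - look t (k - Suc (k div 3))
    else look t (k - Suc (pfst (k div 3))) * look t (k - Suc (psnd (k div 3))))"
    for f :: "nat \<Rightarrow> nat" and k t
  have "recfun (\<lambda>f x. if f \<in> bclass (bcomb_of (a f x)) then 1 else 0)"
  proof (rule recfun_course_of_values[where G = "\<lambda>f x. G f" and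
        H = "\<lambda>f x k. if f \<in> bclass (bcomb_of k) then 1 else 0"])
    show "recfun (\<lambda>f z. G f (pfst (psnd z)) (psnd (psnd z)))"
      unfolding G_def by (intro rec_intros)
    show "G f k t = (if f \<in> bclass (bcomb_of k) then 1 else 0)"
      if t: "\<And>j. j < k \<Longrightarrow> look t (k - Suc j) = (if f \<in> bclass (bcomb_of j) then 1 else 0)"
      for f :: "nat \<Rightarrow> nat" and x k t :: nat
    proof (cases "k mod 3 = 0")
      case True
      then show ?thesis
        by (subst bcomb_of.simps) (simp add: G_def Let_def mem_cylinder_iff)
    next
      case False
      then have "k \<noteq> 0" by auto
      then have "pfst (k div 3) < k" "psnd (k div 3) < k" "k div 3 < k"
        using prod_decode_div_less[of k 3] by auto
      then show ?thesis
        using False by (subst bcomb_of.simps) (simp add: G_def Let_def t)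
    qed
  qed (rule assms)
  then show ?thesis
    by (simp add: recpred_def)
qed

section \<open>Uniformly \<open>\<Sigma>\<close> families of classes\<close>

text \<open>
  Level \<open>n\<close> consists of the uniformly \<open>\<Sigma>\<^sup>0\<^sub>n\<^sub>+\<^sub>1\<close> sequences. The base case by domains of programs
  makes closure under preimages a matter of oracle substitution.
\<close>

primrec sigma_family :: "nat \<Rightarrow> (nat \<Rightarrow> (nat \<Rightarrow> nat) set) \<Rightarrow> bool" where
  "sigma_family 0 S \<longleftrightarrow> (\<exists>p. \<forall>i. S i = {f. run f p i \<noteq> None})"
| "sigma_family (Suc n) S \<longleftrightarrow> (\<exists>T. sigma_family n T \<and> (\<forall>i. S i = (\<Union>m. - T (pair i m))))"

text \<open>The halting form suits oracle substitution, the form with a decidable matrix suits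
  unions and intersections. A halting stage is the witness.\<close>

lemma sigma_family_0_iff:
  "sigma_family 0 S \<longleftrightarrow>
    (\<exists>R. recpred (\<lambda>f z. R f (pfst z) (psnd z)) \<and> (\<forall>i. S i = {f. \<exists>m. R f i m}))"
proof
  assume "sigma_family 0 S"
  then obtain p where p: "\<And>i. S i = {f. run f p i \<noteq> None}"
    by auto
  obtain e where e: "prog_of e = p"
    using surj_prog_of by (metis surjD)
  have "recpred (\<lambda>f z. run_on f {..<psnd z} (prog_of e) (pfst z) \<noteq> None)"
    by (intro rec_intros)
  then show "\<exists>R. recpred (\<lambda>f z. R f (pfst z) (psnd z)) \<and> (\<forall>i. S i = {f. \<exists>m. R f i m})"
    by (intro exI[of _ "\<lambda>f i m. run_on f {..<m} p i \<noteq> None"]) (simp only: e p run_neq_None_iff simp_thms)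
next
  assume "\<exists>R. recpred (\<lambda>f z. R f (pfst z) (psnd z)) \<and> (\<forall>i. S i = {f. \<exists>m. R f i m})"
  then obtain R where "recpred (\<lambda>f z. R f (pfst z) (psnd z))" and S: "\<And>i. S i = {f. \<exists>m. R f i m}"
    by blast
  from this(1) obtain p where
    "\<And>f i. run f p i = (if \<exists>m. R f i m then Some (LEAST m. R f i m) else None)"
    by (rule program_for_search) blast
  then show "sigma_family 0 S"
    by (auto simp: S split: if_splits intro!: exI[of _ p])
qed

section \<open>Closure properties and universal sequences\<close>

lemma sigma_family_reindex:
  assumes "sigma_family n S" "recfun (\<lambda>f. h)"
  shows "sigma_family n (\<lambda>i. S (h i))"
  using assms
proof (induction n arbitrary: S h)
  case 0
  then obtain R where R: "recpred (\<lambda>f z. R f (pfst z) (psnd z))" and S: "\<And>i. S i = {f. \<exists>m. R f i m}"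
    unfolding sigma_family_0_iff by blast
  have "recpred (\<lambda>f z. R f (h (pfst z)) (psnd z))"
    using recpred_comp[OF R, of "\<lambda>f z. pair (h (pfst z)) (psnd z)"]
    by (simp add: rec_intros recfun_comp_computable[OF 0(2)])
  then show ?case
    unfolding sigma_family_0_iff by (auto simp: S intro!: exI[of _ "\<lambda>f i m. R f (h i) m"])
next
  case (Suc n)
  then obtain T where T: "sigma_family n T" and S: "\<And>i. S i = (\<Union>m. - T (pair i m))"
    by auto
  from T have "sigma_family n (\<lambda>z. T (pair (h (pfst z)) (psnd z)))"
    by (rule Suc.IH) (intro rec_intros recfun_comp_computable[OF Suc.prems(2)])
  then show ?case
    by (auto simp: S intro!: exI[of _ "\<lambda>z. T (pair (h (pfst z)) (psnd z))"])
qed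

lemma ex_pfst_psnd: "(\<exists>m. P (pfst m) (psnd m)) \<longleftrightarrow> (\<exists>x y. P x y)"
  by (metis fst_conv prod_encode_inverse snd_conv)

text \<open>A case split suffices: every level starts with an existential number quantifier, and
  pairing merges two of them.\<close>

lemma sigma_family_UN:
  assumes "sigma_family n S"
  shows "sigma_family n (\<lambda>i. \<Union>m. S (pair i m))"
proof (cases n)
  case 0
  then obtain R where R: "recpred (\<lambda>f z. R f (pfst z) (psnd z))" and S: "\<And>i. S i = {f. \<exists>m. R f i m}"
    using assms unfolding 0 sigma_family_0_iff by blast
  have "recpred (\<lambda>f z. R f (pair (pfst z) (pfst (psnd z))) (psnd (psnd z)))"
    using recpred_comp[OF R, of "\<lambda>f z. pair (pair (pfst z) (pfst (psnd z))) (psnd (psnd z))"]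
    by (simp add: rec_intros)
  moreover have "(\<Union>m. S (pair i m)) = {f. \<exists>m. R f (pair i (pfst m)) (psnd m)}" for i
    using ex_pfst_psnd[of "\<lambda>x y. R _ (pair i x) y"] by (auto simp: S)
  ultimately show ?thesis
    unfolding 0 sigma_family_0_iff
    by (intro exI[of _ "\<lambda>f i m. R f (pair i (pfst m)) (psnd m)"]) simp
next
  case (Suc k)
  then obtain T where T: "sigma_family k T" and S: "\<And>i. S i = (\<Union>m. - T (pair i m))"
    using assms by auto
  have "sigma_family k (\<lambda>z. T (pair (pair (pfst z) (pfst (psnd z))) (psnd (psnd z))))"
    using T by (rule sigma_family_reindex) (intro rec_intros)
  moreover have "(\<Union>m. S (pair i m)) = (\<Union>m. - T (pair (pair i (pfst m)) (psnd m)))" for i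
    by (rule Set.set_eqI) (simp add: S ex_pfst_psnd[of "\<lambda>x y. _ \<notin> T (pair (pair i x) y)"])
  ultimately show ?thesis
    unfolding Suc sigma_family.simps
    by (intro exI[of _ "\<lambda>z. T (pair (pair (pfst z) (pfst (psnd z))) (psnd (psnd z)))"]) simp
qed

text \<open>Both closures are proved together because complementation swaps them from one level to
  the next. Intersection pairs two witnesses, while a union can share one.\<close>

lemma sigma_family_Int_Un:
  assumes "sigma_family n S" "sigma_family n S'"
  shows "sigma_family n (\<lambda>i. S i \<inter> S' i) \<and> sigma_family n (\<lambda>i. S i \<union> S' i)"
  using assms
proof (induction n arbitrary: S S')
  case 0
  then obtain R R' where R: "recpred (\<lambda>f z. R f (pfst z) (psnd z))" "\<And>i. S i = {f. \<exists>m. R f i m}"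
    and R': "recpred (\<lambda>f z. R' f (pfst z) (psnd z))" "\<And>i. S' i = {f. \<exists>m. R' f i m}"
    unfolding sigma_family_0_iff by blast
  have "recpred (\<lambda>f z. R f (pfst z) (pfst (psnd z)) \<and> R' f (pfst z) (psnd (psnd z)))"
    using recpred_comp[OF R(1), of "\<lambda>f z. pair (pfst z) (pfst (psnd z))"]
      recpred_comp[OF R'(1), of "\<lambda>f z. pair (pfst z) (psnd (psnd z))"]
    by (intro rec_intros) (simp_all add: rec_intros)
  moreover have "S i \<inter> S' i = {f. \<exists>m. R f i (pfst m) \<and> R' f i (psnd m)}" for i
    using ex_pfst_psnd[of "\<lambda>x y. R _ i x \<and> R' _ i y"] by (auto simp: R(2) R'(2))
  ultimately have "sigma_family 0 (\<lambda>i. S i \<inter> S' i)"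
    unfolding sigma_family_0_iff
    by (intro exI[of _ "\<lambda>f i m. R f i (pfst m) \<and> R' f i (psnd m)"]) simp
  moreover have "recpred (\<lambda>f z. R f (pfst z) (psnd z) \<or> R' f (pfst z) (psnd z))"
    by (intro rec_intros R R')
  then have "sigma_family 0 (\<lambda>i. S i \<union> S' i)"
    unfolding sigma_family_0_iff
    by (intro exI[of _ "\<lambda>f i m. R f i m \<or> R' f i m"]) (auto simp: R(2) R'(2))
  ultimately show ?case by blast
next
  case (Suc n)
  then obtain T T' where T: "sigma_family n T" "\<And>i. S i = (\<Union>m. - T (pair i m))"
    and T': "sigma_family n T'" "\<And>i. S' i = (\<Union>m. - T' (pair i m))"
    by auto
  have "sigma_family n (\<lambda>z. T (pair (pfst z) (pfst (psnd z))))"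
    "sigma_family n (\<lambda>z. T' (pair (pfst z) (psnd (psnd z))))"
    by (rule sigma_family_reindex[OF T(1)] sigma_family_reindex[OF T'(1)], intro rec_intros)+
  from Suc.IH[OF this] have
    "sigma_family n (\<lambda>z. T (pair (pfst z) (pfst (psnd z))) \<union> T' (pair (pfst z) (psnd (psnd z))))"
    by blast
  moreover have "S i \<inter> S' i = (\<Union>m. - (T (pair i (pfst m)) \<union> T' (pair i (psnd m))))" for i
    using ex_pfst_psnd[of "\<lambda>x y. _ \<notin> T (pair i x) \<and> _ \<notin> T' (pair i y)"]
    by (auto simp: T(2) T'(2))
  ultimately have "sigma_family (Suc n) (\<lambda>i. S i \<inter> S' i)"
    unfolding sigma_family.simps
    by (intro exI[of _ "\<lambda>z. T (pair (pfst z) (pfst (psnd z))) \<union> T' (pair (pfst z) (psnd (psnd z)))"])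
      simp
  moreover have "S i \<union> S' i = (\<Union>m. - (T (pair i m) \<inter> T' (pair i m)))" for i
    by (auto simp: T(2) T'(2))
  then have "sigma_family (Suc n) (\<lambda>i. S i \<union> S' i)"
    using Suc.IH[OF T(1) T'(1)] by auto
  ultimately show ?case by blast
qed

text \<open>Decidability survives negation, so a union over a dummy index lifts the class from level
  to level.\<close>

lemma sigma_family_recpred:
  assumes "recpred P"
  shows "sigma_family n (\<lambda>i. {f. P f i})"
  using assms
proof (induction n arbitrary: P)
  case 0
  have "recpred (\<lambda>f z. P f (pfst z))"
    by (intro recpred_comp[OF 0] rec_intros)
  then show ?case
    unfolding sigma_family_0_iff by (intro exI[of _ "\<lambda>f i m. P f i"]) simp
next
  case (Suc n)
  have "recpred (\<lambda>f z. \<not> P f (pfst z))"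
    by (intro recpred_comp[OF Suc.prems] rec_intros)
  from Suc.IH[OF this] show ?case
    unfolding sigma_family.simps by (intro exI[of _ "\<lambda>z. {f. \<not> P f (pfst z)}"]) auto
qed

text \<open>Where \<open>q\<close> with parameter \<open>j\<close> is not total, \<open>S'\<close>
  is unconstrained. Where it is total, an equivalence is claimed and not just an inclusion, so the
  induction can pass through complements.\<close>

lemma sigma_family_preimage:
  assumes "sigma_family n S"
  shows "\<exists>S'. sigma_family n S' \<and>
    (\<forall>f g j i. (\<forall>x. run f q (pair j x) = Some (g x)) \<longrightarrow> (f \<in> S' (pair j i) \<longleftrightarrow> g \<in> S i))"
  using assms
proof (induction n arbitrary: S)
  case 0
  then obtain p where p: "\<And>i. S i = {f. run f p i \<noteq> None}"
    by auto
  have eq: "run f (oracle_subst q p) (pair j i) = run g p i"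
    if "\<forall>x. run f q (pair j x) = Some (g x)" for f g j i
    using that by (intro run_oracle_subst) simp
  show ?case
  proof (intro exI conjI allI impI)
    show "sigma_family 0 (\<lambda>z. {f. run f (oracle_subst q p) z \<noteq> None})"
      by auto
    show "f \<in> {f. run f (oracle_subst q p) (pair j i) \<noteq> None} \<longleftrightarrow> g \<in> S i"
      if "\<forall>x. run f q (pair j x) = Some (g x)" for f g j i
      using eq[OF that] by (simp add: p)
  qed
next
  case (Suc n)
  then obtain T where T: "sigma_family n T" and S: "\<And>i. S i = (\<Union>m. - T (pair i m))"
    by auto
  obtain T' where T': "sigma_family n T'"
    "\<forall>f g j i. (\<forall>x. run f q (pair j x) = Some (g x)) \<longrightarrow> (f \<in> T' (pair j i) \<longleftrightarrow> g \<in> T i)"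
    using Suc.IH[OF T] by blast
  have "sigma_family n (\<lambda>z. T' (pair (pfst (pfst z)) (pair (psnd (pfst z)) (psnd z))))"
    using T'(1) by (rule sigma_family_reindex) (intro rec_intros)
  then have "sigma_family (Suc n) (\<lambda>z. \<Union>m. - T' (pair (pfst z) (pair (psnd z) m)))"
    by (auto intro!: exI[of _ "\<lambda>z. T' (pair (pfst (pfst z)) (pair (psnd (pfst z)) (psnd z)))"])
  moreover have "f \<in> (\<Union>m. - T' (pair j (pair i m))) \<longleftrightarrow> g \<in> S i"
    if "\<forall>x. run f q (pair j x) = Some (g x)" for f g j i
  proof -
    have "f \<in> T' (pair j i) \<longleftrightarrow> g \<in> T i" for i
      using T'(2) that by blast
    then show ?thesis by (simp add: S)
  qed
  ultimately show ?case
    by (intro exI[of _ "\<lambda>z. \<Union>m. - T' (pair (pfst z) (pair (psnd z) m))"] conjI allI impI)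
      simp_all
qed

text \<open>An index of the sequence \<open>T\<close> of complements serves as an index one level
  up, so only level 0 needs the universal program.\<close>

lemma universal_sigma_family:
  "\<exists>V. sigma_family n V \<and> (\<forall>S. sigma_family n S \<longrightarrow> (\<exists>a. \<forall>i. S i = V (pair a i)))"
proof (induction n)
  case 0
  obtain U where U: "\<And>f e x. run f U (pair e x) = run f (prog_of e) x"
    using universal_program by blast
  have "\<exists>a. \<forall>i. S i = {f. run f U (pair a i) \<noteq> None}" if "sigma_family 0 S" for S
    using that surj_prog_of unfolding U by (metis sigma_family.simps(1) surjD)
  then show ?case
    by (intro exI[of _ "\<lambda>z. {f. run f U z \<noteq> None}"]) auto
next
  case (Suc n)
  then obtain V where V: "sigma_family n V" "\<And>S. sigma_family n S \<Longrightarrow> \<exists>a. \<forall>i. S i = V (pair a i)"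
    by blast
  have "sigma_family n (\<lambda>z. V (pair (pfst (pfst z)) (pair (psnd (pfst z)) (psnd z))))"
    using V(1) by (rule sigma_family_reindex) (intro rec_intros)
  then have "sigma_family (Suc n) (\<lambda>z. \<Union>m. - V (pair (pfst z) (pair (psnd z) m)))"
    by (auto intro!: exI[of _ "\<lambda>z. V (pair (pfst (pfst z)) (pair (psnd (pfst z)) (psnd z)))"])
  moreover have "\<exists>a. \<forall>i. S i = (\<Union>m. - V (pair a (pair i m)))" if "sigma_family (Suc n) S" for S
  proof -
    obtain T where "sigma_family n T" "\<And>i. S i = (\<Union>m. - T (pair i m))"
      using \<open>sigma_family (Suc n) S\<close> by auto
    moreover from this(1) obtain a where "\<And>i. T i = V (pair a i)"
      using V(2) by blast
    ultimately show ?thesis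
      by (intro exI[of _ a]) simp
  qed
  ultimately show ?case
    by (intro exI[of _ "\<lambda>z. \<Union>m. - V (pair (pfst z) (pair (psnd z) m))"] conjI allI impI) simp_all
qed

lemma sigma_family_total_preimage:
  assumes "sigma_family n S" "recfun F"
  shows "sigma_family n (\<lambda>i. {f. F f \<in> S i})"
proof -
  obtain p where "\<And>f x. run f p x = Some (F f x)"
    using assms(2) unfolding recfun_def by blast
  \<comment> \<open>There is no parameter to pass on: \<open>Snd\<close> discards it, and it is
    fixed as 0.\<close>
  then have p: "\<forall>x. run f (Comp p Snd) (pair 0 x) = Some (F f x)" for f
    by simp
  obtain S' where S': "sigma_family n S'" "\<And>f g j i.
      \<forall>x. run f (Comp p Snd) (pair j x) = Some (g x) \<Longrightarrow> f \<in> S' (pair j i) \<longleftrightarrow> g \<in> S i"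
    using sigma_family_preimage[OF assms(1), of "Comp p Snd"] by blast
  have "recfun (\<lambda>f. pair 0)"
    by (intro rec_intros)
  from sigma_family_reindex[OF S'(1) this] have "sigma_family n (\<lambda>i. S' (pair 0 i))" .
  moreover have "S' (pair 0 i) = {f. F f \<in> S i}" for i
    using S'(2)[OF p] by auto
  ultimately show ?thesis by simp
qed

text \<open>Guarding each class by the decidable event that its index is enumerated by a given stage
  turns the union over \<open>W\<close> into a union over all numbers.\<close>

lemma sigma_family_Pi_class:
  assumes "recfun (\<lambda>f. u)"
  shows "sigma_family n (\<lambda>i. Pi_class n (u i))"
  using assms
proof (induction n arbitrary: u)
  case 0
  then show ?case
    using sigma_family_recpred[OF recpred_Pi_class_0[OF 0]] by simp
next
  case (Suc n)
  define halts where "halts j x s \<longleftrightarrow> run_on (\<lambda>_. 0) {..<s} (prog_of (u j)) x \<noteq> None" for j x s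
  have "recpred (\<lambda>f z. run_on f {..<psnd (psnd z)} (prog_of (u (pfst z))) (pfst (psnd z)) \<noteq> None)"
    by (intro rec_intros recfun_comp_computable[OF Suc.prems])
  \<comment> \<open>\<open>W\<close> refers to the zero oracle, so the oracle at hand is replaced by
    the constant 0.\<close>
  then have halts: "recpred (\<lambda>f z. halts (pfst z) (pfst (psnd z)) (psnd (psnd z)))"
    unfolding halts_def by (rule recpred_oracle_subst) (rule recfun_const)
  have "recfun (\<lambda>f z. pfst (psnd z))"
    by (intro rec_intros)
  then have "sigma_family n (\<lambda>z. Pi_class n (pfst (psnd z)))"
    by (rule Suc.IH)
  then have "sigma_family n (\<lambda>z. {f. halts (pfst z) (pfst (psnd z)) (psnd (psnd z))} \<inter>
      Pi_class n (pfst (psnd z)))"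
    using sigma_family_Int_Un[OF sigma_family_recpred[OF halts]] by blast
  from sigma_family_UN[OF this]
  have "sigma_family n (\<lambda>j. \<Union>m. {f. halts j (pfst m) (psnd m)} \<inter> Pi_class n (pfst m))"
    by simp
  moreover have "(\<Union>m. {f. halts j (pfst m) (psnd m)} \<inter> Pi_class n (pfst m)) =
      (\<Union>x\<in>W (u j). Pi_class n x)" for j
  proof (rule Set.set_eqI)
    fix f
    show "f \<in> (\<Union>m. {f. halts j (pfst m) (psnd m)} \<inter> Pi_class n (pfst m)) \<longleftrightarrow>
        f \<in> (\<Union>x\<in>W (u j). Pi_class n x)"
      using ex_pfst_psnd[of "\<lambda>x s. halts j x s \<and> f \<in> Pi_class n x"]
      unfolding W_def Phi_def run_neq_None_iff halts_def[symmetric] by auto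
  qed
  ultimately have "sigma_family n (\<lambda>j. \<Union>x\<in>W (u j). Pi_class n x)"
    by simp
  \<comment> \<open>Complementing leads one level up, with a dummy union index that
    \<open>pfst\<close> drops.\<close>
  from sigma_family_reindex[OF this, of pfst] show ?case
    by (auto simp: rec_intros intro!: exI[of _ "\<lambda>z. \<Union>x\<in>W (u (pfst z)). Pi_class n x"])
qed

text \<open>At level 0, a halting computation is witnessed by a finite piece of the oracle, that is,
  by a cylinder. Above that, the complement of a union of listed classes is itself a listed class
  once its indices are enumerated by a program.\<close>

lemma sigma_family_as_UN_Pi_class:
  assumes "sigma_family n S"
  shows "\<exists>u. recfun (\<lambda>f. u) \<and> (\<forall>i. S i = (\<Union>m. Pi_class n (u (pair i m))))"
  using assms
proof (induction n arbitrary: S)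
  case 0
  then obtain p where p: "\<And>i. S i = {f. run f p i \<noteq> None}"
    by auto
  obtain e where e: "prog_of e = p"
    using surj_prog_of by (metis surjD)
  define R where "R i m s \<longleftrightarrow> run_on (\<lambda>k. pfst (code_drop m k - 1)) {..<s} p i \<noteq> None" for i m s
  \<comment> \<open>The nonzero tails say that the coded list has at least \<open>s\<close> entries,
    so it answers every oracle question of the guarded run; hence also \<open>s \<le> m\<close>,
    which makes the bound on \<open>s\<close> harmless.\<close>
  define D where "D i m \<longleftrightarrow> (\<exists>s<Suc m. (\<forall>k<s. code_drop m k \<noteq> 0) \<and> R i m s)" for i m
  \<comment> \<open>\<open>3 * m\<close> codes the cylinder of list \<open>m\<close>; 1 codes the
    complement of the whole space, the empty filler for rejected lists.\<close>
  define u where "u z = (if D (pfst z) (psnd z) then 3 * psnd z else 1)" for z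
  have "recpred (\<lambda>f z. run_on f {..<psnd z} (prog_of e) (pfst (pfst z)) \<noteq> None)"
    by (intro rec_intros)
  then have R: "recpred (\<lambda>f z. R (pfst (pfst z)) (psnd (pfst z)) (psnd z))"
    unfolding R_def e by (rule recpred_oracle_subst) (intro rec_intros)
  have "recpred (\<lambda>f z. D (pfst z) (psnd z))"
    unfolding D_def by (intro rec_intros R)
  then have "recfun (\<lambda>f. u)"
    unfolding u_def by (intro rec_intros)
  moreover have "S i = (\<Union>m. Pi_class 0 (u (pair i m)))" for i
  proof -
    have "bcomb_of 0 = Cyl []" "bcomb_of 1 = Neg (bcomb_of 0)"
      by (subst bcomb_of.simps, simp)+
    then have "Pi_class 0 1 = {}"
      by (simp add: cylinder_def)
    then have u: "f \<in> Pi_class 0 (u (pair i m)) \<longleftrightarrow> D i m \<and> f \<in> cylinder (list_decode m)" for f m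
      by (auto simp: u_def bcomb_of.simps[of "3 * m"])
    have "f \<in> cylinder (list_decode m) \<Longrightarrow> D i m \<Longrightarrow> f \<in> S i" for f m
    proof -
      assume f: "f \<in> cylinder (list_decode m)" and "D i m"
      then obtain s where s: "\<forall>k<s. code_drop m k \<noteq> 0"
        and run: "run_on (\<lambda>k. pfst (code_drop m k - 1)) {..<s} p i \<noteq> None"
        unfolding D_def R_def by blast
      have "pfst (code_drop m k - 1) = f k" if "k \<in> {..<s}" for k
        using code_drop_list_encode[of "list_decode m" k] s f that by (simp add: cylinder_def)
      then have "run_on (\<lambda>k. pfst (code_drop m k - 1)) {..<s} p i = run_on f {..<s} p i"
        by (rule run_on_cong)
      with run have "run_on f {..<s} p i \<noteq> None"
        by simp
      then show "f \<in> S i"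
        unfolding p mem_Collect_eq run_neq_None_iff by blast
    qed
    moreover have "\<exists>m. D i m \<and> f \<in> cylinder (list_decode m)" if f: "f \<in> S i" for f
    proof -
      obtain s where s: "run_on f {..<s} p i \<noteq> None"
        using f unfolding p mem_Collect_eq run_neq_None_iff by blast
      define m where "m = list_encode (map f [0..<s])"
      have drop: "code_drop m k \<noteq> 0" "pfst (code_drop m k - 1) = f k" if "k < s" for k
        using code_drop_list_encode[of "map f [0..<s]" k] that by (auto simp: m_def)
      have "run_on (\<lambda>k. pfst (code_drop m k - 1)) {..<s} p i = run_on f {..<s} p i"
        by (rule run_on_cong) (use drop in auto)
      moreover have "s \<le> m"
        using length_le_list_encode[of "map f [0..<s]"] by (simp add: m_def)
      ultimately have "D i m"
        using s drop(1) unfolding D_def R_def by (intro exI[of _ s]) auto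
      moreover have "f \<in> cylinder (list_decode m)"
        by (simp add: m_def cylinder_def)
      ultimately show ?thesis by blast
    qed
    ultimately show ?thesis
      unfolding set_eq_iff UN_iff u by blast
  qed
  ultimately show ?case by blast
next
  case (Suc n)
  then obtain T where T: "sigma_family n T" and S: "\<And>i. S i = (\<Union>m. - T (pair i m))"
    by auto
  obtain v where v: "recfun (\<lambda>f. v)" and Tv: "\<And>j. T j = (\<Union>k. Pi_class n (v (pair j k)))"
    using Suc.IH[OF T] by blast
  have "recpred (\<lambda>f z. v (pair (pfst (pfst z)) (psnd z)) = psnd (pfst z))"
    by (intro rec_intros recfun_comp_computable[OF v])
  from program_for_search[of "\<lambda>f z k. v (pair (pfst z) k) = psnd z", OF this]
  obtain p where p: "\<And>f z. run f p z = (if \<exists>k. v (pair (pfst z) k) = psnd z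
      then Some (LEAST k. v (pair (pfst z) k) = psnd z) else None)"
    by blast
  obtain c where c: "recfun (\<lambda>f. c)" "\<And>f i x. run f (prog_of (c i)) x = run f p (pair i x)"
    using smn[of p] by blast
  \<comment> \<open>The search halts on exactly the values of \<open>v\<close> in row
    \<open>j\<close>, so a range becomes a domain.\<close>
  have "W (c j) = {v (pair j k) | k. True}" for j
    by (auto simp: W_def Phi_def c(2) p split: if_splits)
  then have "- T j = Pi_class (Suc n) (c j)" for j
    by (auto simp: Tv)
  with c(1) show ?case
    by (intro exI[of _ c]) (simp add: S)
qed

section \<open>Uniform reducibility by \<open>\<Sigma>\<close> families\<close>

lemma Phi_in_iff: "Phi_in e f A \<longleftrightarrow> (\<exists>g\<in>A. \<forall>x. run f (prog_of e) x = Some (g x))"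
  by (simp add: Phi_in_def Phi_def)

lemma unif_leE:
  assumes "unif_le n A B"
  obtains S p where "sigma_family n S" "B \<subseteq> (\<Union>i. S i)"
    "\<And>i f. f \<in> B \<Longrightarrow> f \<in> S i \<Longrightarrow> \<exists>g\<in>A. \<forall>x. run f p (pair i x) = Some (g x)"
proof -
  obtain V u e where V: "\<And>i. V i = Pi_class n (u i)" "B \<subseteq> (\<Union>i. V i)"
    and u: "recfun (\<lambda>f. u)" and "recfun (\<lambda>f. e)"
    and red: "\<And>i f. f \<in> B \<inter> V i \<Longrightarrow> Phi_in (e i) f A"
    using assms unfolding unif_le_def uniformly_Pi_def computable_iff_recfun by blast
  then obtain q where q: "\<And>f i. run f q i = Some (e i)"
    unfolding recfun_def by blast
  obtain U where U: "\<And>f e x. run f U (pair e x) = run f (prog_of e) x"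
    using universal_program by blast
  have "V = (\<lambda>i. Pi_class n (u i))"
    using V(1) by (rule ext)
  then have "sigma_family n V"
    using sigma_family_Pi_class[OF u] by simp
  moreover have "run f (Comp U (Tup (Comp q Fst) Snd)) (pair i x) = run f (prog_of (e i)) x"
    for f i x
    by (simp add: q U)
  ultimately show thesis
    using V(2) red that[of V "Comp U (Tup (Comp q Fst) Snd)"] unfolding Phi_in_iff by simp
qed

lemma unif_leI:
  assumes "sigma_family n S" "B \<subseteq> (\<Union>i. S i)"
    and red: "\<And>i f. f \<in> B \<Longrightarrow> f \<in> S i \<Longrightarrow> \<exists>g\<in>A. \<forall>x. run f p (pair i x) = Some (g x)"
  shows "unif_le n A B"
proof -
  obtain u where u: "recfun (\<lambda>f. u)" and S: "\<And>i. S i = (\<Union>m. Pi_class n (u (pair i m)))"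
    using sigma_family_as_UN_Pi_class[OF assms(1)] by blast
  \<comment> \<open>The index \<open>z\<close> codes a class \<open>i\<close> and one of its pieces;
    the program needs only \<open>i\<close>, extracted by \<open>Comp Fst Fst\<close>.\<close>
  obtain c where c: "recfun (\<lambda>f. c)"
    "\<And>f z x. run f (prog_of (c z)) x = run f (Comp p (Tup (Comp Fst Fst) Snd)) (pair z x)"
    using smn[of "Comp p (Tup (Comp Fst Fst) Snd)"] by blast
  have "f \<in> S (pfst z)" if "f \<in> Pi_class n (u z)" for f z
    using that unfolding S by (intro UN_I[of "psnd z"]) simp_all
  then have "Phi_in (c z) f A" if "f \<in> B \<inter> Pi_class n (u z)" for f z
    using red[of f "pfst z"] that by (simp add: Phi_in_iff c(2))
  moreover have "B \<subseteq> (\<Union>z. Pi_class n (u z))"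
    using assms(2) by (auto simp: S)
  moreover have "uniformly_Pi n (\<lambda>z. Pi_class n (u z))" "computable c"
    using u c(1) by (auto simp: uniformly_Pi_def computable_iff_recfun)
  ultimately show ?thesis
    unfolding unif_le_def by blast
qed

lemma unif_le_recfun:
  assumes "recfun F" "\<And>f. f \<in> B \<Longrightarrow> F f \<in> A"
  shows "unif_le n A B"
proof -
  obtain p where p: "\<And>f x. run f p x = Some (F f x)"
    using assms(1) unfolding recfun_def by blast
  have "recpred (\<lambda>f x. True)"
    by (simp add: recpred_def recfun_const)
  from sigma_family_recpred[OF this] show ?thesis
    by (rule unif_leI[where p = "Comp p Snd"]) (use assms(2) in \<open>auto simp: p\<close>)
qed

lemma unif_le_subset: "B \<subseteq> A \<Longrightarrow> unif_le n A B"
  by (rule unif_le_recfun[of "\<lambda>f x. f x"]) (auto intro: rec_intros)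

text \<open>An index pairs a class \<open>T j\<close> containing \<open>f\<close> with a class
  \<open>S i\<close> containing its image. Intersecting with \<open>T j\<close> ensures that
  \<open>q\<close> is total at \<open>f\<close> in \<open>C\<close>, which is where the preimage
  \<open>S'\<close> is meaningful.\<close>

lemma unif_le_trans:
  assumes "unif_le n A B" "unif_le n B C"
  shows "unif_le n A C"
proof -
  obtain S p where S: "sigma_family n S" "B \<subseteq> (\<Union>i. S i)"
    "\<And>i f. f \<in> B \<Longrightarrow> f \<in> S i \<Longrightarrow> \<exists>g\<in>A. \<forall>x. run f p (pair i x) = Some (g x)"
    using assms(1) by (rule unif_leE) (rule that)
  obtain T q where T: "sigma_family n T" "C \<subseteq> (\<Union>j. T j)"
    "\<And>j f. f \<in> C \<Longrightarrow> f \<in> T j \<Longrightarrow> \<exists>g\<in>B. \<forall>x. run f q (pair j x) = Some (g x)"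
    using assms(2) by (rule unif_leE) (rule that)
  obtain S' where S': "sigma_family n S'" "\<And>f g j i.
      \<forall>x. run f q (pair j x) = Some (g x) \<Longrightarrow> f \<in> S' (pair j i) \<longleftrightarrow> g \<in> S i"
    using sigma_family_preimage[OF S(1), of q] by blast
  let ?r = "Comp (oracle_subst q p) (Tup (Comp Fst Fst) (Tup (Comp Snd Fst) Snd))"
  show ?thesis
  proof (rule unif_leI)
    have "recfun (\<lambda>f. pfst)"
      by (intro rec_intros)
    then show "sigma_family n (\<lambda>z. T (pfst z) \<inter> S' z)"
      using sigma_family_Int_Un[OF sigma_family_reindex[OF T(1)] S'(1)] by blast
    show "C \<subseteq> (\<Union>z. T (pfst z) \<inter> S' z)"
    proof
      fix f assume f: "f \<in> C"
      then obtain j where j: "f \<in> T j"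
        using T(2) by blast
      then obtain g where g: "g \<in> B" "\<forall>x. run f q (pair j x) = Some (g x)"
        using T(3) f by blast
      then obtain i where "g \<in> S i"
        using S(2) by blast
      then have "f \<in> T (pfst (pair j i)) \<inter> S' (pair j i)"
        using S'(2)[OF g(2)] j by simp
      then show "f \<in> (\<Union>z. T (pfst z) \<inter> S' z)"
        by blast
    qed
    fix z f assume f: "f \<in> C" "f \<in> T (pfst z) \<inter> S' z"
    then obtain g where g: "g \<in> B" "\<forall>x. run f q (pair (pfst z) x) = Some (g x)"
      using T(3) by blast
    then have "g \<in> S (psnd z)"
      using f(2) S'(2)[OF g(2), of "psnd z"] by simp
    then obtain h where "h \<in> A" "\<forall>x. run g p (pair (psnd z) x) = Some (h x)"
      using S(3) g(1) by blast
    moreover have "run f (oracle_subst q p) (pair (pfst z) x) = run g p x" for x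
      using g(2) by (intro run_oracle_subst) simp
    ultimately show "\<exists>h\<in>A. \<forall>x. run f ?r (pair z x) = Some (h x)"
      by (intro bexI[of _ h]) simp_all
  qed
qed

section \<open>Join, meet and implication of mass problems\<close>

text \<open>Pointwise pairing replaces interleaving: both components are read off without arithmetic
  on positions.\<close>

definition mass_join :: "mass_problem \<Rightarrow> mass_problem \<Rightarrow> mass_problem" where
  "mass_join A B = {h. (\<lambda>x. pfst (h x)) \<in> A \<and> (\<lambda>x. psnd (h x)) \<in> B}"

text \<open>A disjoint union in which every nonzero tag selects \<open>B\<close>, so no tag is
  illegal.\<close>

definition mass_meet :: "mass_problem \<Rightarrow> mass_problem \<Rightarrow> mass_problem" where
  "mass_meet A B = {h. (\<lambda>x. h (Suc x)) \<in> (if h 0 = 0 then A else B)}"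

lemma mass_join_upper: "unif_le n A (mass_join A B)" "unif_le n B (mass_join A B)"
proof -
  have "recfun (\<lambda>f x. pfst (f x))" "recfun (\<lambda>f x. psnd (f x))"
    by (intro rec_intros)+
  then show "unif_le n A (mass_join A B)" "unif_le n B (mass_join A B)"
    by (auto intro: unif_le_recfun simp: mass_join_def)
qed

lemma mass_join_least:
  assumes "unif_le n A C" "unif_le n B C"
  shows "unif_le n (mass_join A B) C"
proof -
  obtain S p where S: "sigma_family n S" "C \<subseteq> (\<Union>i. S i)"
    "\<And>i f. f \<in> C \<Longrightarrow> f \<in> S i \<Longrightarrow> \<exists>g\<in>A. \<forall>x. run f p (pair i x) = Some (g x)"
    using assms(1) by (rule unif_leE) (rule that)
  obtain T q where T: "sigma_family n T" "C \<subseteq> (\<Union>i. T i)"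
    "\<And>i f. f \<in> C \<Longrightarrow> f \<in> T i \<Longrightarrow> \<exists>g\<in>B. \<forall>x. run f q (pair i x) = Some (g x)"
    using assms(2) by (rule unif_leE) (rule that)
  let ?r = "Tup (Comp p (Tup (Comp Fst Fst) Snd)) (Comp q (Tup (Comp Snd Fst) Snd))"
  show ?thesis
  proof (rule unif_leI)
    have "recfun (\<lambda>f. pfst)" "recfun (\<lambda>f. psnd)"
      by (intro rec_intros)+
    then show "sigma_family n (\<lambda>z. S (pfst z) \<inter> T (psnd z))"
      using sigma_family_Int_Un sigma_family_reindex S(1) T(1) by blast
    show "C \<subseteq> (\<Union>z. S (pfst z) \<inter> T (psnd z))"
    proof
      fix f assume "f \<in> C"
      then obtain i j where "f \<in> S i" "f \<in> T j"
        using S(2) T(2) by blast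
      then have "f \<in> S (pfst (pair i j)) \<inter> T (psnd (pair i j))"
        by simp
      then show "f \<in> (\<Union>z. S (pfst z) \<inter> T (psnd z))"
        by blast
    qed
    fix z f assume f: "f \<in> C" "f \<in> S (pfst z) \<inter> T (psnd z)"
    then obtain g h where "g \<in> A" "h \<in> B" "\<forall>x. run f p (pair (pfst z) x) = Some (g x)"
      "\<forall>x. run f q (pair (psnd z) x) = Some (h x)"
      using S(3) T(3) by blast
    then show "\<exists>k\<in>mass_join A B. \<forall>x. run f ?r (pair z x) = Some (k x)"
      by (intro bexI[of _ "\<lambda>x. pair (g x) (h x)"]) (simp_all add: mass_join_def)
  qed
qed

lemma mass_join_mono_right:
  "unif_le n B C \<Longrightarrow> unif_le n (mass_join A B) (mass_join A C)"
  by (meson mass_join_least mass_join_upper unif_le_trans)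

lemma unif_le_prepend:
  assumes "\<And>f. f \<in> B \<Longrightarrow> (\<lambda>x. if x = 0 then c else f (x - 1)) \<in> A"
  shows "unif_le n A B"
proof (rule unif_le_recfun)
  show "recfun (\<lambda>f x. if x = 0 then c else f (x - 1))"
    by (intro rec_intros)
qed (rule assms)

lemma mass_meet_lower: "unif_le n (mass_meet A B) A" "unif_le n (mass_meet A B) B"
  by (rule unif_le_prepend[of _ 0], simp add: mass_meet_def)
    (rule unif_le_prepend[of _ 1], simp add: mass_meet_def)

text \<open>The tag is decidable, so the two covers can share their indices, with the tag deciding
  which one applies.\<close>

lemma mass_meet_greatest:
  assumes "unif_le n C A" "unif_le n C B"
  shows "unif_le n C (mass_meet A B)"
proof -
  obtain S p where S: "sigma_family n S" "A \<subseteq> (\<Union>i. S i)"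
    "\<And>i f. f \<in> A \<Longrightarrow> f \<in> S i \<Longrightarrow> \<exists>g\<in>C. \<forall>x. run f p (pair i x) = Some (g x)"
    using assms(1) by (rule unif_leE) (rule that)
  obtain T q where T: "sigma_family n T" "B \<subseteq> (\<Union>i. T i)"
    "\<And>i f. f \<in> B \<Longrightarrow> f \<in> T i \<Longrightarrow> \<exists>g\<in>C. \<forall>x. run f q (pair i x) = Some (g x)"
    using assms(2) by (rule unif_leE) (rule that)
  define tail where "tail = Comp Oracle (Comp Succ Snd)"
  have tail: "run h tail (pair j x) = Some (h (Suc x))" for h j x
    by (simp add: tail_def)
  obtain U where U: "\<And>f e x. run f U (pair e x) = run f (prog_of e) x"
    using universal_program by blast
  obtain a b where a: "prog_of a = oracle_subst tail p" and b: "prog_of b = oracle_subst tail q"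
    using surj_prog_of by (metis surjD)
  \<comment> \<open>\<open>recfun_if\<close> only treats total branches, and \<open>p\<close> and
    \<open>q\<close> may diverge. The tag therefore selects a program code, which \<open>U\<close>
    runs.\<close>
  have "recfun (\<lambda>h x. if h 0 = 0 then a else b)"
    by (intro rec_intros)
  then obtain r where r: "\<And>h x. run h r x = Some (if h 0 = 0 then a else b)"
    unfolding recfun_def by blast
  show ?thesis
  proof (rule unif_leI)
    have 0: "recfun (\<lambda>h x. h (Suc x))" "recpred (\<lambda>h x. h 0 = 0)" "recpred (\<lambda>h x. h 0 \<noteq> 0)"
      by (intro rec_intros)+
    show "sigma_family n (\<lambda>i. {h. h 0 = 0} \<inter> {h. (\<lambda>x. h (Suc x)) \<in> S i} \<union>
        {h. h 0 \<noteq> 0} \<inter> {h. (\<lambda>x. h (Suc x)) \<in> T i})"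
      by (intro sigma_family_Int_Un[THEN conjunct1] sigma_family_Int_Un[THEN conjunct2]
          sigma_family_recpred sigma_family_total_preimage[OF S(1)]
          sigma_family_total_preimage[OF T(1)] 0)
    show "mass_meet A B \<subseteq> (\<Union>i. {h. h 0 = 0} \<inter> {h. (\<lambda>x. h (Suc x)) \<in> S i} \<union>
        {h. h 0 \<noteq> 0} \<inter> {h. (\<lambda>x. h (Suc x)) \<in> T i})"
    proof
      fix h assume h: "h \<in> mass_meet A B"
      show "h \<in> (\<Union>i. {h. h 0 = 0} \<inter> {h. (\<lambda>x. h (Suc x)) \<in> S i} \<union>
        {h. h 0 \<noteq> 0} \<inter> {h. (\<lambda>x. h (Suc x)) \<in> T i})"
        using h S(2) T(2) by (cases "h 0 = 0") (auto simp: mass_meet_def)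
    qed
    fix i h
    assume h: "h \<in> mass_meet A B"
      "h \<in> {h. h 0 = 0} \<inter> {h. (\<lambda>x. h (Suc x)) \<in> S i} \<union>
        {h. h 0 \<noteq> 0} \<inter> {h. (\<lambda>x. h (Suc x)) \<in> T i}"
    have subst: "run h (oracle_subst tail p) (pair 0 x) = run (\<lambda>x. h (Suc x)) p x" for p x
      by (rule run_oracle_subst) (rule tail)
    show "\<exists>g\<in>C. \<forall>x. run h (Comp U (Tup r (Tup Zero (Tup Fst Snd)))) (pair i x) = Some (g x)"
    proof (cases "h 0 = 0")
      case True
      then show ?thesis
        using h S(3)[of "\<lambda>x. h (Suc x)" i] by (simp add: r U a subst mass_meet_def)
    next
      case False
      then show ?thesis
        using h T(3)[of "\<lambda>x. h (Suc x)" i] by (simp add: r U b subst mass_meet_def)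
    qed
  qed
qed

lemma mass_implication_exists:
  "\<exists>C. \<forall>D. unif_le n B (mass_join A D) \<longleftrightarrow> unif_le n C D"
proof -
  obtain V where V: "sigma_family n V" "\<And>S. sigma_family n S \<Longrightarrow> \<exists>a. \<forall>i. S i = V (pair a i)"
    using universal_sigma_family by blast
  obtain U where U: "\<And>f e x. run f U (pair e x) = run f (prog_of e) x"
    using universal_program by blast
  \<comment> \<open>Correctness is demanded for every class containing \<open>j\<close>, as
    \<open>unif_leI\<close> requires; a reduction cannot choose its class.\<close>
  define reduces where "reduces k j \<longleftrightarrow> (\<exists>i. j \<in> V (pair (pfst k) i)) \<and>
    (\<forall>i. j \<in> V (pair (pfst k) i) \<longrightarrow>
      (\<exists>g\<in>B. \<forall>x. run j U (pair (psnd k) (pair i x)) = Some (g x)))" for k j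
  define C where "C = {h. \<forall>g\<in>A. reduces (h 0) (\<lambda>x. pair (g x) (h (Suc x)))}"
  have "unif_le n B (mass_join A C)"
  proof -
    have "recfun (\<lambda>h z. pair (pfst (h (psnd z))) (psnd (h (Suc (psnd z)))))"
      by (intro rec_intros)
    then obtain q where "\<And>h z. run h q z = Some (pair (pfst (h (psnd z))) (psnd (h (Suc (psnd z)))))"
      unfolding recfun_def by blast
    then have q: "run h q (pair j x) = Some (pair (pfst (h x)) (psnd (h (Suc x))))" for h j x
      by simp
    have red: "reduces (psnd (h 0)) (\<lambda>x. pair (pfst (h x)) (psnd (h (Suc x))))"
      if "h \<in> mass_join A C" for h
      using that by (auto simp: mass_join_def C_def)
    \<comment> \<open>The input is \<open>pair z x\<close> with \<open>z = pair k i\<close>;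
      \<open>U\<close> is to run program \<open>psnd k\<close> on \<open>pair i x\<close>, with 0 as
      dummy parameter for \<open>q\<close>.\<close>
    let ?r = "Comp (oracle_subst q U)
      (Tup Zero (Tup (Comp Snd (Comp Fst Fst)) (Tup (Comp Snd Fst) Snd)))"
    show ?thesis
    proof (rule unif_leI)
      have 0: "recpred (\<lambda>h z. psnd (h 0) = pfst z)"
        "recfun (\<lambda>h x. pair (pfst (h x)) (psnd (h (Suc x))))"
        "recfun (\<lambda>f z. pair (pfst (pfst z)) (psnd z))"
        by (intro rec_intros)+
      \<comment> \<open>The decidable first condition forces the code in the class index to agree
        with the one stored in \<open>h\<close>.\<close>
      show "sigma_family n (\<lambda>z. {h. psnd (h 0) = pfst z} \<inter>
          {h. (\<lambda>x. pair (pfst (h x)) (psnd (h (Suc x)))) \<in> V (pair (pfst (pfst z)) (psnd z))})"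
        by (intro sigma_family_Int_Un[THEN conjunct1] sigma_family_recpred 0
            sigma_family_total_preimage[OF sigma_family_reindex[OF V(1)]])
      show "mass_join A C \<subseteq> (\<Union>z. {h. psnd (h 0) = pfst z} \<inter>
          {h. (\<lambda>x. pair (pfst (h x)) (psnd (h (Suc x)))) \<in> V (pair (pfst (pfst z)) (psnd z))})"
      proof
        fix h assume "h \<in> mass_join A C"
        from red[OF this] obtain i where
          "(\<lambda>x. pair (pfst (h x)) (psnd (h (Suc x)))) \<in> V (pair (pfst (psnd (h 0))) i)"
          unfolding reduces_def by blast
        then show "h \<in> (\<Union>z. {h. psnd (h 0) = pfst z} \<inter>
          {h. (\<lambda>x. pair (pfst (h x)) (psnd (h (Suc x)))) \<in> V (pair (pfst (pfst z)) (psnd z))})"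
          by (intro UN_I[of "pair (psnd (h 0)) i"]) auto
      qed
      fix z h
      assume h: "h \<in> mass_join A C"
        "h \<in> {h. psnd (h 0) = pfst z} \<inter> {h. (\<lambda>x. pair (pfst (h x)) (psnd (h (Suc x)))) \<in> V (pair (pfst (pfst z)) (psnd z))}"
      have "run h (oracle_subst q U) (pair 0 x) =
          run (\<lambda>x. pair (pfst (h x)) (psnd (h (Suc x)))) U x" for x
        by (rule run_oracle_subst) (rule q)
      then show "\<exists>g\<in>B. \<forall>x. run h ?r (pair z x) = Some (g x)"
        using red[OF h(1)] h(2) by (simp add: reduces_def)
    qed
  qed
  then have "unif_le n B (mass_join A D)" if "unif_le n C D" for D
    using that mass_join_mono_right unif_le_trans by blast
  moreover have "unif_le n C D" if BD: "unif_le n B (mass_join A D)" for D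
  proof -
    obtain S p where S: "sigma_family n S" "mass_join A D \<subseteq> (\<Union>i. S i)"
      "\<And>i f. f \<in> mass_join A D \<Longrightarrow> f \<in> S i \<Longrightarrow> \<exists>g\<in>B. \<forall>x. run f p (pair i x) = Some (g x)"
      using BD by (rule unif_leE) (rule that)
    obtain a where a: "\<And>i. S i = V (pair a i)"
      using V(2) S(1) by blast
    obtain b where b: "prog_of b = p"
      using surj_prog_of by (metis surjD)
    \<comment> \<open>Universality of \<open>V\<close> gives the cover an index \<open>a\<close>, so
      the single code \<open>pair a b\<close> serves all of \<open>D\<close>.\<close>
    have "reduces (pair a b) f" if "f \<in> mass_join A D" for f
      using S(2,3) that by (auto simp: reduces_def U b a[symmetric])
    then show ?thesis
      by (intro unif_le_prepend[of _ "pair a b"]) (auto simp: C_def mass_join_def)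
  qed
  ultimately show ?thesis by blast
qed

section \<open>The degree structure\<close>

definition degree :: "nat \<Rightarrow> mass_problem \<Rightarrow> mass_problem set" where
  "degree n A = unif_equiv n `` {A}"

lemma equiv_unif_equiv: "equiv UNIV (unif_equiv n)"
proof (intro equivI refl_onI symI transI)
  show "(A, C) \<in> unif_equiv n" if "(A, B) \<in> unif_equiv n" "(B, C) \<in> unif_equiv n" for A B C
    using that unif_le_trans[of n A B C] unif_le_trans[of n C B A] by (simp add: unif_equiv_def)
qed (auto simp: unif_equiv_def intro: unif_le_subset)

lemma carrier_uniform_degrees: "carrier (uniform_degrees n) = range (degree n)"
  by (auto simp: uniform_degrees_def quotient_def degree_def)

lemma eq_uniform_degrees: "eq (uniform_degrees n) = (=)"
  by (simp add: uniform_degrees_def)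

lemma degree_eq_iff: "degree n A = degree n B \<longleftrightarrow> unif_le n A B \<and> unif_le n B A"
  unfolding degree_def eq_equiv_class_iff[OF equiv_unif_equiv UNIV_I UNIV_I]
  by (simp add: unif_equiv_def)

lemma le_degree_iff: "degree n A \<sqsubseteq>\<^bsub>uniform_degrees n\<^esub> degree n B \<longleftrightarrow> unif_le n A B"
proof
  assume "degree n A \<sqsubseteq>\<^bsub>uniform_degrees n\<^esub> degree n B"
  then obtain A' B' where "unif_le n A A'" "unif_le n A' B'" "unif_le n B' B"
    by (auto simp: uniform_degrees_def degree_def unif_equiv_def)
  then show "unif_le n A B"
    by (meson unif_le_trans)
next
  have "A \<in> degree n A" for A
    by (simp add: degree_def unif_equiv_def unif_le_subset)
  moreover assume "unif_le n A B"
  ultimately show "degree n A \<sqsubseteq>\<^bsub>uniform_degrees n\<^esub> degree n B"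
    by (auto simp: uniform_degrees_def)
qed

lemma least_Upper_degree:
  "least (uniform_degrees n) (degree n (mass_join A B))
    (Upper (uniform_degrees n) {degree n A, degree n B})"
proof (rule least_UpperI)
  show "x \<sqsubseteq>\<^bsub>uniform_degrees n\<^esub> degree n (mass_join A B)" if "x \<in> {degree n A, degree n B}" for x
    using that mass_join_upper by (auto simp: le_degree_iff)
  fix y assume y: "y \<in> Upper (uniform_degrees n) {degree n A, degree n B}"
  then obtain C where "y = degree n C"
    by (auto simp: Upper_def carrier_uniform_degrees)
  moreover have "degree n A \<sqsubseteq>\<^bsub>uniform_degrees n\<^esub> y" "degree n B \<sqsubseteq>\<^bsub>uniform_degrees n\<^esub> y"
    using y by (simp_all add: Upper_def carrier_uniform_degrees)
  ultimately show "degree n (mass_join A B) \<sqsubseteq>\<^bsub>uniform_degrees n\<^esub> y"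
    by (simp add: le_degree_iff mass_join_least)
qed (auto simp: carrier_uniform_degrees)

lemma greatest_Lower_degree:
  "greatest (uniform_degrees n) (degree n (mass_meet A B))
    (Lower (uniform_degrees n) {degree n A, degree n B})"
proof (rule greatest_LowerI)
  show "degree n (mass_meet A B) \<sqsubseteq>\<^bsub>uniform_degrees n\<^esub> x" if "x \<in> {degree n A, degree n B}" for x
    using that mass_meet_lower by (auto simp: le_degree_iff)
  fix y assume y: "y \<in> Lower (uniform_degrees n) {degree n A, degree n B}"
  then obtain C where "y = degree n C"
    by (auto simp: Lower_def carrier_uniform_degrees)
  moreover have "y \<sqsubseteq>\<^bsub>uniform_degrees n\<^esub> degree n A" "y \<sqsubseteq>\<^bsub>uniform_degrees n\<^esub> degree n B"
    using y by (simp_all add: Lower_def carrier_uniform_degrees)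
  ultimately show "y \<sqsubseteq>\<^bsub>uniform_degrees n\<^esub> degree n (mass_meet A B)"
    by (simp add: le_degree_iff mass_meet_greatest)
qed (auto simp: carrier_uniform_degrees)

lemma bounded_lattice_uniform_degrees: "bounded_lattice (uniform_degrees n)"
proof
  show "\<exists>s. least (uniform_degrees n) s (Upper (uniform_degrees n) {x, y})"
    if "x \<in> carrier (uniform_degrees n)" "y \<in> carrier (uniform_degrees n)" for x y
    using that least_Upper_degree unfolding carrier_uniform_degrees by blast
  show "\<exists>s. greatest (uniform_degrees n) s (Lower (uniform_degrees n) {x, y})"
    if "x \<in> carrier (uniform_degrees n)" "y \<in> carrier (uniform_degrees n)" for x y
    using that greatest_Lower_degree unfolding carrier_uniform_degrees by blast
  \<comment> \<open>Every function solves \<open>UNIV\<close>, so it is the easiest problem.\<close>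
  show "\<exists>x. least (uniform_degrees n) x (carrier (uniform_degrees n))"
    by (rule exI[of _ "degree n UNIV"])
      (auto simp: least_def carrier_uniform_degrees le_degree_iff intro: unif_le_subset)
  \<comment> \<open>The empty problem has no solutions, so everything reduces to it
    vacuously.\<close>
  show "\<exists>x. greatest (uniform_degrees n) x (carrier (uniform_degrees n))"
    by (rule exI[of _ "degree n {}"])
      (auto simp: greatest_def carrier_uniform_degrees le_degree_iff intro: unif_le_subset)
  show "x \<sqsubseteq>\<^bsub>uniform_degrees n\<^esub> z"
    if "x \<sqsubseteq>\<^bsub>uniform_degrees n\<^esub> y" "y \<sqsubseteq>\<^bsub>uniform_degrees n\<^esub> z"
      "x \<in> carrier (uniform_degrees n)" "y \<in> carrier (uniform_degrees n)"
      "z \<in> carrier (uniform_degrees n)" for x y z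
    using that by (auto simp: carrier_uniform_degrees le_degree_iff dest: unif_le_trans)
  show "x .=\<^bsub>uniform_degrees n\<^esub> y"
    if le: "x \<sqsubseteq>\<^bsub>uniform_degrees n\<^esub> y" "y \<sqsubseteq>\<^bsub>uniform_degrees n\<^esub> x"
      and xy: "x \<in> carrier (uniform_degrees n)" "y \<in> carrier (uniform_degrees n)" for x y
  proof -
    obtain A B where "x = degree n A" "y = degree n B"
      using xy unfolding carrier_uniform_degrees by blast
    with le show ?thesis
      by (simp add: eq_uniform_degrees le_degree_iff degree_eq_iff)
  qed
qed (auto simp: eq_uniform_degrees carrier_uniform_degrees le_degree_iff
    intro: unif_le_subset)

text \<open>
  Distributivity comes for free: \<open>c \<mapsto> a \<squnion> c\<close> has the lower adjoint \<open>imp a\<close>, so it preserves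
  meets.
\<close>

lemma (in bounded_lattice) brouwer_algebraI:
  assumes residual: "\<And>a b. a \<in> carrier L \<Longrightarrow> b \<in> carrier L \<Longrightarrow>
    \<exists>d\<in>carrier L. \<forall>c\<in>carrier L. b \<sqsubseteq> a \<squnion> c \<longleftrightarrow> d \<sqsubseteq> c"
  shows "brouwer_algebra L"
proof
  show "x \<squnion> (y \<sqinter> z) = (x \<squnion> y) \<sqinter> (x \<squnion> z)"
    if [simp]: "x \<in> carrier L" "y \<in> carrier L" "z \<in> carrier L" for x y z
  proof -
    let ?b = "(x \<squnion> y) \<sqinter> (x \<squnion> z)"
    obtain d where [simp]: "d \<in> carrier L" and d: "\<And>c. c \<in> carrier L \<Longrightarrow> ?b \<sqsubseteq> x \<squnion> c \<longleftrightarrow> d \<sqsubseteq> c"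
      using residual[of x ?b] by auto
    have "d \<sqsubseteq> y" "d \<sqsubseteq> z"
      using d[of y] d[of z] meet_left[of "x \<squnion> y" "x \<squnion> z"] meet_right[of "x \<squnion> y" "x \<squnion> z"] by simp_all
    then have "d \<sqsubseteq> y \<sqinter> z"
      by (simp add: meet_le)
    then have "?b \<sqsubseteq> x \<squnion> (y \<sqinter> z)"
      using d[of "y \<sqinter> z"] by simp
    moreover have "x \<squnion> (y \<sqinter> z) \<sqsubseteq> x \<squnion> w" if "y \<sqinter> z \<sqsubseteq> w" and [simp]: "w \<in> carrier L" for w
      using that le_trans[OF that(1) join_right[of x w]] by (simp add: join_le join_left)
    then have "x \<squnion> (y \<sqinter> z) \<sqsubseteq> ?b"
      by (simp add: meet_le meet_left meet_right)
    ultimately show ?thesis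
      by (simp add: le_antisym)
  qed
  define imp where "imp a b = (SOME d. d \<in> carrier L \<and>
    (\<forall>c\<in>carrier L. b \<sqsubseteq> a \<squnion> c \<longleftrightarrow> d \<sqsubseteq> c))" for a b
  have *: "imp a b \<in> carrier L \<and> (\<forall>c\<in>carrier L. b \<sqsubseteq> a \<squnion> c \<longleftrightarrow> imp a b \<sqsubseteq> c)"
    if "a \<in> carrier L" "b \<in> carrier L" for a b
    unfolding imp_def by (rule someI_ex) (use residual[OF that] in blast)
  show "\<exists>imp \<in> carrier L \<rightarrow> carrier L \<rightarrow> carrier L.
      \<forall>a\<in>carrier L. \<forall>b\<in>carrier L. \<forall>c\<in>carrier L. b \<sqsubseteq> a \<squnion> c \<longleftrightarrow> imp a b \<sqsubseteq> c"
  proof (rule bexI[of _ imp])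
    show "\<forall>a\<in>carrier L. \<forall>b\<in>carrier L. \<forall>c\<in>carrier L. b \<sqsubseteq> a \<squnion> c \<longleftrightarrow> imp a b \<sqsubseteq> c"
      by (intro ballI) (rule *[THEN conjunct2, THEN bspec])
    show "imp \<in> carrier L \<rightarrow> carrier L \<rightarrow> carrier L"
      by (intro Pi_I) (rule *[THEN conjunct1])
  qed
qed

theorem proposition2p6:
  fixes n :: nat
  shows "brouwer_algebra (uniform_degrees n)"
proof -
  interpret bounded_lattice "uniform_degrees n"
    by (rule bounded_lattice_uniform_degrees)
  have join: "degree n A \<squnion>\<^bsub>uniform_degrees n\<^esub> degree n B = degree n (mass_join A B)" for A B
  proof (rule joinI)
    show "l = degree n (mass_join A B)"
      if "least (uniform_degrees n) l (Upper (uniform_degrees n) {degree n A, degree n B})" for l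
      using that least_Upper_degree by (rule least_unique)
  qed (simp_all add: carrier_uniform_degrees)
  show ?thesis
  proof (rule brouwer_algebraI)
    fix a b
    assume "a \<in> carrier (uniform_degrees n)" "b \<in> carrier (uniform_degrees n)"
    then obtain A B where [simp]: "a = degree n A" "b = degree n B"
      unfolding carrier_uniform_degrees by blast
    obtain C where "\<And>D. unif_le n B (mass_join A D) \<longleftrightarrow> unif_le n C D"
      using mass_implication_exists by blast
    then have "\<forall>c\<in>carrier (uniform_degrees n).
        b \<sqsubseteq>\<^bsub>uniform_degrees n\<^esub> a \<squnion>\<^bsub>uniform_degrees n\<^esub> c \<longleftrightarrow>
          degree n C \<sqsubseteq>\<^bsub>uniform_degrees n\<^esub> c"
      by (simp add: carrier_uniform_degrees join le_degree_iff)
    then show "\<exists>d\<in>carrier (uniform_degrees n). \<forall>c\<in>carrier (uniform_degrees n).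
        b \<sqsubseteq>\<^bsub>uniform_degrees n\<^esub> a \<squnion>\<^bsub>uniform_degrees n\<^esub> c \<longleftrightarrow> d \<sqsubseteq>\<^bsub>uniform_degrees n\<^esub> c"
      unfolding carrier_uniform_degrees by (rule bexI) simp
  qed
qed

end
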